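(* Let $\Gamma\subset\mathbb{P}^3$ be the twisted cubic curve over $\mathbb{C}$. The tangential developable $F$ of $\Gamma$ is the unique irreducible surface of degree $4$ in $\mathbb{P}^3$ which has $\Gamma$ as a cuspidal curve.
   Context: Everything is over $\mathbb{C}$. The twisted cubic $\Gamma$ is the image of $\mathbb{P}^1$ under $(t_0,t_1)\mapsto(t_0^3,t_0^2t_1,t_0t_1^2,t_1^3)$. The tangential developable of $\Gamma$ is the union of the tangent lines to $\Gamma$. A quartic surface $F=\{F=0\}$ has $\Gamma$ as a double curve if $F\in H^0(\mathbb{P}^3,\mathcal{I}_\Gamma^2(4))$, where $\mathcal{I}_\Gamma$ is the ideal sheaf of $\Gamma$; then $F$ induces a section of $\mathrm{Sym}^2(\mathcal{N}^*_\Gamma(2))$, where $\mathcal{N}^*_\Gamma(2)=(\mathcal{I}_\Gamma/\mathcal{I}_\Gamma^2)(2)$ is the twisted conormal bundle (of rank $2$). A point $x\in\Gamma$ is a pinch point of $F$ if the binary quadratic form induced by $F$ on the fibre at $x$ has zero discriminant. $\Gamma$ is a cuspidal curve for $F$ if it is a double curve and this discriminant vanishes identically along $\Gamma$ (every point of $\Gamma$ is a pinch point). *)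

theory Defs
  imports
    "HOL-Analysis.Analysis"
    "HOL-Library.Poly_Mapping"
    "HOL-Computational_Algebra.Factorial_Ring"
begin

text \<open>
  The homogeneous coordinate ring of \<open>P\<^sup>3\<close> over the complex numbers, with variables indexed by
  the four-element type \<^typ>\<open>4\<close> whose elements are \<open>0, 1, 2, 3\<close>.  A point of \<open>P\<^sup>3\<close> is given by
  a non-zero vector of homogeneous coordinates, and a subset of \<open>P\<^sup>3\<close> by the set of all non-zero
  coordinate vectors of its points; such a set is closed under non-zero scaling.
\<close>

type_synonym cpoly4 = "(4 \<Rightarrow>\<^sub>0 nat) \<Rightarrow>\<^sub>0 complex"

definition const_poly :: "complex \<Rightarrow> cpoly4" where
  "const_poly c = Poly_Mapping.single 0 c"

definition eval_poly :: "cpoly4 \<Rightarrow> complex ^ 4 \<Rightarrow> complex" where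
  "eval_poly f v =
     (\<Sum>m\<in>Poly_Mapping.keys f. Poly_Mapping.lookup f m * (\<Prod>i\<in>UNIV. (v $ i) ^ Poly_Mapping.lookup m i))"

text \<open>The zero polynomial is homogeneous of every degree.\<close>

definition homogeneous :: "nat \<Rightarrow> cpoly4 \<Rightarrow> bool" where
  "homogeneous d f \<longleftrightarrow> (\<forall>m\<in>Poly_Mapping.keys f. (\<Sum>i\<in>UNIV. Poly_Mapping.lookup m i) = d)"

definition zero_locus :: "cpoly4 \<Rightarrow> (complex ^ 4) set" where
  "zero_locus f = {v. v \<noteq> 0 \<and> eval_poly f v = 0}"

definition vanishing_ideal :: "(complex ^ 4) set \<Rightarrow> cpoly4 set" where
  "vanishing_ideal C = {f. \<forall>v\<in>C. eval_poly f v = 0}"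

text \<open>The ring is a module over itself, and the submodules are the ideals.\<close>

definition ideal_generated :: "cpoly4 set \<Rightarrow> cpoly4 set" where
  "ideal_generated S = module.span (*) S"

definition ideal_square :: "cpoly4 set \<Rightarrow> cpoly4 set" where
  "ideal_square I = ideal_generated {f * g | f g. f \<in> I \<and> g \<in> I}"

definition ideal_cube :: "cpoly4 set \<Rightarrow> cpoly4 set" where
  "ideal_cube I = ideal_generated {f * g * h | f g h. f \<in> I \<and> g \<in> I \<and> h \<in> I}"

text \<open>
  An irreducible surface of degree \<open>d\<close>, given by its equation, which is determined up to a
  non-zero constant.
\<close>

definition irreducible_surface :: "nat \<Rightarrow> cpoly4 \<Rightarrow> bool" where
  "irreducible_surface d F \<longleftrightarrow> homogeneous d F \<and> irreducible F"

definition twisted_cubic_map :: "complex \<Rightarrow> complex \<Rightarrow> complex ^ 4" where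
  "twisted_cubic_map s t =
     (\<chi> i. if i = 0 then s ^ 3 else if i = 1 then s ^ 2 * t else if i = 2 then s * t ^ 2 else t ^ 3)"

definition twisted_cubic :: "(complex ^ 4) set" where
  "twisted_cubic = {c *s twisted_cubic_map s t | c s t. c \<noteq> 0 \<and> (s, t) \<noteq> (0, 0)}"

text \<open>
  The embedded projective tangent space at \<open>p\<close>: the points \<open>v\<close> such that the derivative of
  every equation of \<open>C\<close> at \<open>p\<close> in the direction \<open>v\<close> is zero.
\<close>

definition tangent_line :: "(complex ^ 4) set \<Rightarrow> complex ^ 4 \<Rightarrow> (complex ^ 4) set" where
  "tangent_line C p =
     {v. v \<noteq> 0 \<and> (\<forall>f\<in>vanishing_ideal C.
            ((\<lambda>z. eval_poly f (p + z *s v)) has_field_derivative 0) (at 0))}"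

definition tangential_developable :: "(complex ^ 4) set \<Rightarrow> (complex ^ 4) set" where
  "tangential_developable C = (\<Union>p\<in>C. tangent_line C p)"

text \<open>
  Write \<open>\<I>\<close> for the ideal sheaf of \<open>C\<close>.  The stalk at \<open>p\<close> of a power of \<open>\<I>\<close>, suitably twisted,
  consists of the fractions \<open>u / h\<close> with \<open>u\<close>, \<open>h\<close> homogeneous, \<open>u\<close> in that power of the homogeneous
  ideal of \<open>C\<close> and \<open>h\<close> not vanishing at \<open>p\<close>.  Below, such denominators are always cleared.

  A form \<open>F\<close> of degree \<open>n\<close> is a global section of \<open>\<I>\<^sup>2(n)\<close> iff it lies in the stalk of \<open>\<I>\<^sup>2(n)\<close>
  at every point of \<open>P\<^sup>3\<close>.
\<close>

definition double_curve :: "(complex ^ 4) set \<Rightarrow> nat \<Rightarrow> cpoly4 \<Rightarrow> bool" where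
  "double_curve C n F \<longleftrightarrow> homogeneous n F \<and>
     (\<forall>p. p \<noteq> 0 \<longrightarrow> (\<exists>k h. homogeneous k h \<and> eval_poly h p \<noteq> 0 \<and>
        h * F \<in> ideal_square (vanishing_ideal C)))"

text \<open>
  Forms \<open>f\<close>, \<open>g\<close> of degree \<open>d\<close> in the ideal of \<open>C\<close> whose classes generate the stalk at \<open>p\<close> of the
  conormal sheaf \<open>(\<I>/\<I>\<^sup>2)(d)\<close>.  Where this sheaf is locally free of rank 2, they form a local frame
  near \<open>p\<close> and their values at \<open>p\<close> a basis of its fibre.  Passing to the twist
  \<open>(\<I>/\<I>\<^sup>2)(2)\<close> only multiplies \<open>f\<close> and \<open>g\<close> by a common unit of the local ring, up to which
  every local frame of that sheaf is of this form.
\<close>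

definition conormal_frame ::
    "(complex ^ 4) set \<Rightarrow> complex ^ 4 \<Rightarrow> nat \<Rightarrow> cpoly4 \<Rightarrow> cpoly4 \<Rightarrow> bool" where
  "conormal_frame C p d f g \<longleftrightarrow>
     f \<in> vanishing_ideal C \<and> homogeneous d f \<and> g \<in> vanishing_ideal C \<and> homogeneous d g \<and>
     (\<forall>e u. u \<in> vanishing_ideal C \<and> homogeneous e u \<longrightarrow>
        (\<exists>k l h a b. homogeneous k h \<and> eval_poly h p \<noteq> 0 \<and>
           homogeneous l a \<and> homogeneous l b \<and> k + e = l + d \<and>
           h * u - (a * f + b * g) \<in> ideal_square (vanishing_ideal C)))"

text \<open>
  The section of \<open>Sym\<^sup>2(\<I>/\<I>\<^sup>2)(n) = (\<I>\<^sup>2/\<I>\<^sup>3)(n)\<close> induced by a form \<open>F\<close> of degree \<open>n\<close> equals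
  \<open>(a f\<^sup>2 + b f g + c g\<^sup>2) / h\<close> near \<open>p\<close>, so that, up to a non-zero factor,
  \<open>a(p) X\<^sup>2 + b(p) X Y + c(p) Y\<^sup>2\<close> is the binary quadratic form induced on the fibre at \<open>p\<close>,
  written in the basis \<open>f\<close>, \<open>g\<close>.
\<close>

definition induced_form ::
    "(complex ^ 4) set \<Rightarrow> nat \<Rightarrow> cpoly4 \<Rightarrow> complex ^ 4 \<Rightarrow> nat \<Rightarrow> cpoly4 \<Rightarrow> cpoly4 \<Rightarrow>
     complex \<Rightarrow> complex \<Rightarrow> complex \<Rightarrow> bool" where
  "induced_form C n F p d f g \<alpha> \<beta> \<gamma> \<longleftrightarrow>
     (\<exists>k l h a b c. homogeneous k h \<and> eval_poly h p \<noteq> 0 \<and>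
        homogeneous l a \<and> homogeneous l b \<and> homogeneous l c \<and> k + n = l + 2 * d \<and>
        h * F - (a * f ^ 2 + b * f * g + c * g ^ 2) \<in> ideal_cube (vanishing_ideal C) \<and>
        \<alpha> = eval_poly a p / eval_poly h p \<and>
        \<beta> = eval_poly b p / eval_poly h p \<and>
        \<gamma> = eval_poly c p / eval_poly h p)"

text \<open>
  A change of frame multiplies the discriminant by the square of a non-zero number, so its
  vanishing does not depend on the frame chosen.
\<close>

definition pinch_point :: "(complex ^ 4) set \<Rightarrow> nat \<Rightarrow> cpoly4 \<Rightarrow> complex ^ 4 \<Rightarrow> bool" where
  "pinch_point C n F p \<longleftrightarrow> p \<in> C \<and>
     (\<exists>d f g \<alpha> \<beta> \<gamma>. conormal_frame C p d f g \<and> induced_form C n F p d f g \<alpha> \<beta> \<gamma> \<and>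
        \<beta> ^ 2 - 4 * \<alpha> * \<gamma> = 0)"

definition cuspidal_curve :: "(complex ^ 4) set \<Rightarrow> nat \<Rightarrow> cpoly4 \<Rightarrow> bool" where
  "cuspidal_curve C n F \<longleftrightarrow> double_curve C n F \<and> (\<forall>p\<in>C. pinch_point C n F p)"

end

theory Submission
  imports Defs "HOL-Computational_Algebra.Fundamental_Theorem_Algebra"
begin

text \<open>
  Write \<open>\<gamma>(s, t)\<close> for the parametrisation of the curve and \<open>q\<^sub>0 = x\<^sub>0 x\<^sub>2 - x\<^sub>1\<^sup>2\<close>, \<open>q\<^sub>1 = x\<^sub>0 x\<^sub>3 - x\<^sub>1 x\<^sub>2\<close>,
  \<open>q\<^sub>2 = x\<^sub>1 x\<^sub>3 - x\<^sub>2\<^sup>2\<close> for the quadrics through it.  The developable is the surface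
  \<open>q\<^sub>1\<^sup>2 - 4 q\<^sub>0 q\<^sub>2 = 0\<close>: a general point lies on a unique secant, the parameters of whose two points on the
  curve are the roots of \<open>q\<^sub>0 T\<^sup>2 - q\<^sub>1 T + q\<^sub>2\<close>, and the secant is a tangent when they coincide
  (\<open>zero_locus_discriminant_quartic\<close>).

  The quartic is irreducible because its zero set has a polynomial parametrisation.  One factor of a
  product vanishes on the whole zero set.  On general lines parallel to the \<open>x\<^sub>3\<close>-axis and to the
  \<open>x\<^sub>0\<close>-axis, where the quartic has simple roots, the other factor is then constant; this
  forces it to have no zeros (\<open>irreducible_discriminant_quartic\<close>).  It is cuspidal along the curve because
  in a local frame made of two of the quadrics its discriminant is a multiple of a quadric
  (\<open>cuspidal_curve_discriminant_quartic\<close>).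

  For uniqueness, let \<open>G\<close> be a cuspidal quartic.  At a point of the curve its second order
  term is the square of a linear form that vanishes on the tangent line.  On a secant, \<open>G\<close> has two
  double zeros, so \<open>G(z \<gamma>(1, a) + w \<gamma>(1, b)) = z\<^sup>2 w\<^sup>2 (b - a)\<^sup>4 N(a, b)\<close>, where \<open>N\<close> is symmetric and, for
  each \<open>a\<close>, is the square of a polynomial of degree at most one in \<open>b\<close>.  The only such
  \<open>N\<close> are multiples of \<open>(a - b)\<^sup>2\<close> and squares of symmetric forms \<open>\<alpha> + \<beta> (a + b) + \<gamma> a b\<close> (\<open>symmetric_biquadratic_of_squares\<close>).  The first kind
  belongs to multiples of the developable, the second to squares of quadrics through
  the curve (\<open>cuspidal_quartic_cases\<close>), which are reducible.
\<close>

section \<open>Polynomials in four variables as functions\<close>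

lemma UNIV_4_from_0: "(UNIV :: 4 set) = {0, 1, 2, 3}"
proof -
  have "(4 :: 4) = 0" by simp
  then show ?thesis
    using UNIV_4 by (metis insert_commute)
qed

lemma prod_4_from_0: "(\<Prod>i\<in>(UNIV :: 4 set). f i) = f 0 * f 1 * f 2 * f 3"
  unfolding UNIV_4_from_0 by (simp add: mult_ac)

lemma forall_4_from_0: "(\<forall>i::4. P i) \<longleftrightarrow> P 0 \<and> P 1 \<and> P 2 \<and> P 3"
proof -
  have "(\<forall>i::4. P i) \<longleftrightarrow> (\<forall>i\<in>{0, 1, 2, 3 :: 4}. P i)"
    by (metis UNIV_4_from_0 UNIV_I)
  then show ?thesis by simp
qed

definition vec4 :: "complex \<Rightarrow> complex \<Rightarrow> complex \<Rightarrow> complex \<Rightarrow> complex ^ 4" where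
  "vec4 a b c d = (\<chi> i. if i = 0 then a else if i = 1 then b else if i = 2 then c else d)"

lemma vec4_nth [simp]:
  "vec4 a b c d $ 0 = a" "vec4 a b c d $ 1 = b" "vec4 a b c d $ 2 = c" "vec4 a b c d $ 3 = d"
  by (simp_all add: vec4_def)

lemma vec_4_eq_iff: "v = w \<longleftrightarrow> v $ 0 = w $ 0 \<and> v $ 1 = w $ 1 \<and> v $ 2 = w $ 2 \<and> v $ 3 = w $ 3"
  for v w :: "'a ^ 4"
  by (simp add: vec_eq_iff forall_4_from_0)

lemma vec4_collapse: "vec4 (v $ 0) (v $ 1) (v $ 2) (v $ 3) = v"
  by (simp add: vec_4_eq_iff)

definition var :: "4 \<Rightarrow> cpoly4" where
  "var i = Poly_Mapping.single (Poly_Mapping.single i 1) 1"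

lemma cpoly4_as_sum: "f = (\<Sum>m\<in>Poly_Mapping.keys f. Poly_Mapping.single m (Poly_Mapping.lookup f m))"
  for f :: cpoly4
proof (rule poly_mapping_eqI)
  fix k
  show "Poly_Mapping.lookup f k =
    Poly_Mapping.lookup (\<Sum>m\<in>Poly_Mapping.keys f. Poly_Mapping.single m (Poly_Mapping.lookup f m)) k"
    by (cases "k \<in> Poly_Mapping.keys f")
      (auto simp: lookup_sum lookup_single when_def sum.delta in_keys_iff)
qed

lemma eval_poly_superset:
  assumes "finite S" "Poly_Mapping.keys f \<subseteq> S"
  shows "eval_poly f v =
    (\<Sum>m\<in>S. Poly_Mapping.lookup f m * (\<Prod>i\<in>UNIV. (v $ i) ^ Poly_Mapping.lookup m i))"
  unfolding eval_poly_def
  by (rule sum.mono_neutral_left) (use assms in \<open>auto simp: in_keys_iff\<close>)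

lemma eval_poly_single:
  "eval_poly (Poly_Mapping.single m c) v = c * (\<Prod>i\<in>UNIV. (v $ i) ^ Poly_Mapping.lookup m i)"
  by (subst eval_poly_superset[of "{m}"]) auto

lemma eval_poly_0 [simp]: "eval_poly 0 v = 0"
  by (simp add: eval_poly_def)

lemma eval_poly_const [simp]: "eval_poly (const_poly c) v = c"
  by (simp add: const_poly_def eval_poly_single)

lemma eval_poly_1 [simp]: "eval_poly 1 v = 1"
  using eval_poly_const[of 1 v] by (simp add: const_poly_def)

lemma eval_poly_var [simp]: "eval_poly (var i) v = v $ i"
proof -
  have "(\<Prod>j\<in>UNIV. (v $ j) ^ Poly_Mapping.lookup (Poly_Mapping.single i 1) j)
      = (\<Prod>j\<in>UNIV. if j = i then v $ j else 1)"
    by (rule prod.cong) (auto simp: lookup_single when_def)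
  then show ?thesis
    by (simp add: var_def eval_poly_single)
qed

lemma eval_poly_add [simp]: "eval_poly (f + g) v = eval_poly f v + eval_poly g v"
proof -
  let ?S = "Poly_Mapping.keys f \<union> Poly_Mapping.keys g"
  have "eval_poly h v = (\<Sum>m\<in>?S. Poly_Mapping.lookup h m * (\<Prod>i\<in>UNIV. (v $ i) ^ Poly_Mapping.lookup m i))"
    if "Poly_Mapping.keys h \<subseteq> ?S" for h
    by (rule eval_poly_superset) (use that in auto)
  then show ?thesis
    using keys_add[of f g] by (simp add: lookup_add ring_distribs sum.distrib)
qed

lemma eval_poly_sum: "eval_poly (sum f A) v = (\<Sum>x\<in>A. eval_poly (f x) v)"
  by (induction A rule: infinite_finite_induct) auto

lemma eval_poly_mult [simp]: "eval_poly (f * g) v = eval_poly f v * eval_poly g v"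
proof -
  let ?s = "\<lambda>f :: cpoly4. \<lambda>m. Poly_Mapping.single m (Poly_Mapping.lookup f m)"
  have "eval_poly (f * g) v = eval_poly ((\<Sum>m\<in>Poly_Mapping.keys f. ?s f m) * (\<Sum>m\<in>Poly_Mapping.keys g. ?s g m)) v"
    by (simp flip: cpoly4_as_sum)
  also have "\<dots> = (\<Sum>m\<in>Poly_Mapping.keys f. eval_poly (?s f m) v) * (\<Sum>m\<in>Poly_Mapping.keys g. eval_poly (?s g m) v)"
    by (simp add: sum_product eval_poly_sum mult_single eval_poly_single lookup_add power_add
        prod.distrib mult_ac)
  also have "\<dots> = eval_poly f v * eval_poly g v"
    by (simp add: eval_poly_sum[symmetric] flip: cpoly4_as_sum)
  finally show ?thesis .
qed

lemma eval_poly_uminus [simp]: "eval_poly (- f) v = - eval_poly f v"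
  using eval_poly_add[of f "- f" v] by (simp add: add_eq_0_iff)

lemma eval_poly_diff [simp]: "eval_poly (f - g) v = eval_poly f v - eval_poly g v"
  using eval_poly_add[of f "- g" v] by simp

lemma eval_poly_power [simp]: "eval_poly (f ^ n) v = eval_poly f v ^ n"
  by (induction n) auto

lemma eval_poly_numeral [simp]: "eval_poly (numeral n) v = numeral n"
  using eval_poly_const[of "numeral n" v] by (simp add: const_poly_def)

section \<open>Homogeneous polynomials\<close>

lemma homogeneous_0 [simp]: "homogeneous d 0"
  by (simp add: homogeneous_def)

lemma homogeneous_const [simp]: "homogeneous 0 (const_poly c)"
  by (auto simp: homogeneous_def const_poly_def)

lemma homogeneous_1 [simp]: "homogeneous 0 1"
  using homogeneous_const[of 1] by (simp add: const_poly_def)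

lemma homogeneous_var [simp]: "homogeneous (Suc 0) (var i)"
  by (auto simp: homogeneous_def var_def lookup_single when_def sum.delta)

lemma homogeneous_add: "homogeneous d f \<Longrightarrow> homogeneous d g \<Longrightarrow> homogeneous d (f + g)"
  using keys_add[of f g] by (auto simp: homogeneous_def)

lemma homogeneous_uminus: "homogeneous d f \<Longrightarrow> homogeneous d (- f)"
  by (auto simp: homogeneous_def in_keys_iff)

lemma homogeneous_diff: "homogeneous d f \<Longrightarrow> homogeneous d g \<Longrightarrow> homogeneous d (f - g)"
  using homogeneous_add[of d f "- g"] homogeneous_uminus[of d g] by simp

lemma homogeneous_mult: "homogeneous d f \<Longrightarrow> homogeneous e g \<Longrightarrow> homogeneous (d + e) (f * g)"
  using keys_mult[of f g] by (fastforce simp: homogeneous_def lookup_add sum.distrib)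

lemma homogeneous_power: "homogeneous d f \<Longrightarrow> homogeneous (d * n) (f ^ n)"
  by (induction n) (auto intro: homogeneous_mult)

lemma homogeneous_const_mult: "homogeneous d f \<Longrightarrow> homogeneous d (const_poly c * f)"
  using homogeneous_mult[OF homogeneous_const] by fastforce

lemma homogeneous_numeral_mult: "homogeneous d f \<Longrightarrow> homogeneous d (numeral n * f)"
  using homogeneous_const_mult[of d f "numeral n"] by (simp add: const_poly_def)

lemma homogeneous_mult_eq:
  "homogeneous d f \<Longrightarrow> homogeneous e g \<Longrightarrow> n = d + e \<Longrightarrow> homogeneous n (f * g)"
  by (simp add: homogeneous_mult)

lemma homogeneous_power_eq: "homogeneous d f \<Longrightarrow> n = d * k \<Longrightarrow> homogeneous n (f ^ k)"
  by (simp add: homogeneous_power)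

text \<open>
  Splitting variables off its monomials reduces a form to constants.  The step for variables
  raises the degree by one, which keeps track of the degrees of cofactors when the induction is used
  for ideal membership.
\<close>

lemma homogeneous_induct [consumes 1, case_names zero const mult_var add]:
  assumes hom: "homogeneous e f"
    and zero: "\<And>e. P e 0"
    and const: "\<And>c. P 0 (const_poly c)"
    and mult_var: "\<And>e i u. homogeneous e u \<Longrightarrow> P e u \<Longrightarrow> P (Suc e) (var i * u)"
    and add: "\<And>e u v. P e u \<Longrightarrow> P e v \<Longrightarrow> P e (u + v)"
  shows "P e f"
proof -
  have mono: "P e (Poly_Mapping.single m c)"
    if "(\<Sum>i\<in>UNIV. Poly_Mapping.lookup m i) = e" for m :: "4 \<Rightarrow>\<^sub>0 nat" and c e
    using that
  proof (induction e arbitrary: m)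
    case 0
    then have "m = 0"
      by (intro poly_mapping_eqI) auto
    then show ?case
      using const by (simp add: const_poly_def)
  next
    case (Suc e)
    then obtain i where i: "Poly_Mapping.lookup m i > 0"
      by (metis gr0I less_numeral_extra(3) sum.neutral zero_less_Suc)
    define m' where "m' = m - Poly_Mapping.single i 1"
    have m: "m = Poly_Mapping.single i 1 + m'"
      by (rule poly_mapping_eqI)
        (use i in \<open>auto simp: m'_def lookup_add lookup_minus lookup_single when_def\<close>)
    have "(\<Sum>i\<in>UNIV. Poly_Mapping.lookup m i) = 1 + (\<Sum>i\<in>UNIV. Poly_Mapping.lookup m' i)"
      unfolding m by (simp add: lookup_add sum.distrib lookup_single when_def sum.delta)
    with Suc have e: "(\<Sum>i\<in>UNIV. Poly_Mapping.lookup m' i) = e"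
      by simp
    then have "homogeneous e (Poly_Mapping.single m' c)"
      by (auto simp: homogeneous_def)
    then have "P (Suc e) (var i * Poly_Mapping.single m' c)"
      using Suc.IH[OF e] by (rule mult_var)
    then show ?case
      unfolding m by (simp add: var_def mult_single)
  qed
  have "P e (\<Sum>m\<in>S. Poly_Mapping.single m (Poly_Mapping.lookup f m))"
    if "finite S" "S \<subseteq> Poly_Mapping.keys f" for S
    using that
  proof (induction S rule: finite_induct)
    case (insert m S)
    then show ?case
      using hom by (auto intro!: add mono simp: homogeneous_def)
  qed (simp add: zero)
  from this[of "Poly_Mapping.keys f"] show ?thesis
    by (simp flip: cpoly4_as_sum)
qed

lemma cpoly4_induct [case_names const mult_var add]:
  assumes const: "\<And>c. P (const_poly c)"
    and mult_var: "\<And>i u. P u \<Longrightarrow> P (var i * u)"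
    and add: "\<And>u v. P u \<Longrightarrow> P v \<Longrightarrow> P (u + v)"
  shows "P f"
proof -
  have zero: "P 0"
    using const[of 0] by (simp add: const_poly_def)
  have mono: "P (Poly_Mapping.single m c)" for m c
  proof -
    have "homogeneous (\<Sum>i\<in>UNIV. Poly_Mapping.lookup m i) (Poly_Mapping.single m c)"
      by (auto simp: homogeneous_def)
    then show ?thesis
      by (induction rule: homogeneous_induct) (auto intro: zero const mult_var add)
  qed
  have "P (\<Sum>m\<in>S. Poly_Mapping.single m (Poly_Mapping.lookup f m))" if "finite S" for S
    using that by (induction S rule: finite_induct) (auto intro!: zero add mono)
  from this[of "Poly_Mapping.keys f"] show ?thesis
    by (simp flip: cpoly4_as_sum)
qed

lemma eval_poly_scale:
  assumes "homogeneous d f"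
  shows "eval_poly f (c *s v) = c ^ d * eval_poly f v"
  using assms by (induction rule: homogeneous_induct) (auto simp: algebra_simps)

section \<open>Restriction to polynomial curves\<close>

text \<open>
  The pullback of \<open>f\<close> to the curve whose coordinates are the univariate polynomials \<open>P i\<close>.  Identities
  between polynomials in several variables are reduced to univariate ones along such curves.
\<close>

definition curve_poly :: "cpoly4 \<Rightarrow> (4 \<Rightarrow> complex poly) \<Rightarrow> complex poly" where
  "curve_poly f P =
     (\<Sum>m\<in>Poly_Mapping.keys f. smult (Poly_Mapping.lookup f m) (\<Prod>i\<in>UNIV. P i ^ Poly_Mapping.lookup m i))"

lemma poly_curve_poly [simp]: "poly (curve_poly f P) z = eval_poly f (\<chi> i. poly (P i) z)"
  by (simp add: curve_poly_def eval_poly_def poly_sum poly_prod)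

lemma poly_eqI_complex: "p = q" if "\<And>z. poly p z = poly q z" for p q :: "complex poly"
  using that poly_eq_poly_eq_iff by blast

lemma curve_poly_simps [simp]:
  "curve_poly 0 P = 0"
  "curve_poly (const_poly c) P = [:c:]"
  "curve_poly (var i) P = P i"
  "curve_poly (f + g) P = curve_poly f P + curve_poly g P"
  "curve_poly (f - g) P = curve_poly f P - curve_poly g P"
  "curve_poly (f * g) P = curve_poly f P * curve_poly g P"
  "curve_poly (f ^ n) P = curve_poly f P ^ n"
  by (auto intro!: poly_eqI_complex)

text \<open>
  Kronecker substitution: for \<open>N\<close> larger than all exponents that occur, the curve with coordinates
  \<open>z, z ^ N, z ^ (N ^ 2), z ^ (N ^ 3)\<close> sends different monomials to different powers of \<open>z\<close>.
\<close>

lemma eval_poly_eq_0_imp: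
  assumes "\<And>v. eval_poly f v = 0"
  shows "f = 0"
proof (rule ccontr)
  assume "f \<noteq> 0"
  then obtain m where m: "m \<in> Poly_Mapping.keys f"
    by (metis in_keys_iff lookup_zero poly_mapping_eqI)
  let ?l = "Poly_Mapping.lookup :: (4 \<Rightarrow>\<^sub>0 nat) \<Rightarrow> 4 \<Rightarrow> nat"
  define N where "N = Suc (Max ((\<lambda>(k, i). ?l k i) ` (Poly_Mapping.keys f \<times> UNIV)))"
  have less: "?l k i < N" if "k \<in> Poly_Mapping.keys f" for k i
    unfolding N_def less_Suc_eq_le by (rule Max_ge) (use that in force)+
  define w where "w k = ?l k 0 + N * (?l k 1 + N * (?l k 2 + N * ?l k 3))" for k
  define P where "P i = monom (1 :: complex) (if i = 0 then 1 else if i = 1 then N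
    else if i = 2 then N * N else N * N * N)" for i :: 4
  have digit: "a = a' \<and> b = b'" if "a + N * b = a' + N * b'" "a < N" "a' < N" for a b a' b'
  proof -
    have "(a + N * b) mod N = (a' + N * b') mod N"
      using that(1) by (rule arg_cong)
    then have "a = a'"
      using that(2,3) by simp
    with that show ?thesis by simp
  qed
  have inj: "k = m" if "w k = w m" "k \<in> Poly_Mapping.keys f" for k
  proof -
    note less = less[OF that(2)] less[OF m]
    note 0 = digit[OF that(1)[unfolded w_def] less(1) less(2)]
    note 1 = digit[OF conjunct2[OF 0] less(1) less(2)]
    note 2 = digit[OF conjunct2[OF 1] less(1) less(2)]
    have "?l k 0 = ?l m 0" "?l k 1 = ?l m 1" "?l k 2 = ?l m 2" "?l k 3 = ?l m 3"
      using 0 1 2 by blast+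
    then show ?thesis
      using forall_4_from_0[of "\<lambda>i. ?l k i = ?l m i"] by (intro poly_mapping_eqI) simp
  qed
  have mono: "(\<Prod>i\<in>UNIV. P i ^ ?l k i) = monom 1 (w k)" for k
    by (simp add: prod_4_from_0 P_def monom_power mult_monom w_def algebra_simps)
  have "coeff (curve_poly f P) (w m)
      = (\<Sum>k\<in>Poly_Mapping.keys f. if k = m then Poly_Mapping.lookup f k else 0)"
    unfolding curve_poly_def coeff_sum using inj by (intro sum.cong) (auto simp: mono)
  also have "\<dots> = Poly_Mapping.lookup f m"
    using m by simp
  finally have "curve_poly f P \<noteq> 0"
    using m by (auto simp: in_keys_iff)
  moreover have "curve_poly f P = 0"
    by (rule poly_eqI_complex) (simp add: assms)
  ultimately show False by simp
qed

lemma eval_poly_eqI: "f = g" if "\<And>v. eval_poly f v = eval_poly g v"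
  using eval_poly_eq_0_imp[of "f - g"] that by simp

section \<open>Directional derivatives\<close>

definition line_poly :: "cpoly4 \<Rightarrow> complex ^ 4 \<Rightarrow> complex ^ 4 \<Rightarrow> complex poly" where
  "line_poly f p v = curve_poly f (\<lambda>i. [:p $ i, v $ i:])"

definition deriv_at :: "cpoly4 \<Rightarrow> complex ^ 4 \<Rightarrow> complex ^ 4 \<Rightarrow> complex" where
  "deriv_at f p v = coeff (line_poly f p v) (Suc 0)"

lemma poly_line_poly: "poly (line_poly f p v) z = eval_poly f (p + z *s v)"
proof -
  have "(\<chi> i. poly [:p $ i, v $ i:] z) = p + z *s v"
    by (simp add: vec_eq_iff)
  then show ?thesis
    by (simp add: line_poly_def)
qed

lemma line_poly_simps [simp]:
  "line_poly (f + g) p v = line_poly f p v + line_poly g p v"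
  "line_poly (f - g) p v = line_poly f p v - line_poly g p v"
  "line_poly (f * g) p v = line_poly f p v * line_poly g p v"
  "line_poly (f ^ n) p v = line_poly f p v ^ n"
  "line_poly 0 p v = 0"
  by (simp_all add: line_poly_def)

lemma coeff_mult_1:
  "coeff (p * q) (Suc 0) = coeff p 0 * coeff q (Suc 0) + coeff p (Suc 0) * coeff q 0"
  for p q :: "complex poly"
  by (simp add: coeff_mult)

lemma coeff_curve_poly_0: "coeff (curve_poly f P) 0 = eval_poly f (\<chi> i. coeff (P i) 0)"
  by (simp flip: poly_0_coeff_0)

lemma coeff_line_poly_0: "coeff (line_poly f p v) 0 = eval_poly f p"
  by (simp add: line_poly_def coeff_curve_poly_0)

lemma deriv_at_simps [simp]:
  "deriv_at (const_poly c) p v = 0"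
  "deriv_at (var i) p v = v $ i"
  "deriv_at (f + g) p v = deriv_at f p v + deriv_at g p v"
  "deriv_at (f - g) p v = deriv_at f p v - deriv_at g p v"
  "deriv_at (f * g) p v = eval_poly f p * deriv_at g p v + deriv_at f p v * eval_poly g p"
  by (simp_all add: deriv_at_def line_poly_def coeff_mult_1 coeff_curve_poly_0)

text \<open>The chain rule: both sides are derivations in \<open>f\<close> that agree on the variables.\<close>

lemma coeff_curve_poly_1:
  "coeff (curve_poly f P) (Suc 0) = deriv_at f (\<chi> i. coeff (P i) 0) (\<chi> i. coeff (P i) (Suc 0))"
  by (induction f rule: cpoly4_induct) (simp_all add: coeff_mult_1 coeff_curve_poly_0)

lemma deriv_at_add: "deriv_at f p (v + w) = deriv_at f p v + deriv_at f p w"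
  by (induction f rule: cpoly4_induct) (simp_all add: algebra_simps)

lemma deriv_at_scale: "deriv_at f p (c *s v) = c * deriv_at f p v"
  by (induction f rule: cpoly4_induct) (simp_all add: algebra_simps)

lemma has_field_derivative_0_iff_deriv_at:
  "((\<lambda>z. eval_poly f (p + z *s v)) has_field_derivative 0) (at 0) \<longleftrightarrow> deriv_at f p v = 0"
proof -
  have "((\<lambda>z. eval_poly f (p + z *s v)) has_field_derivative deriv_at f p v) (at 0)"
    using poly_DERIV[of "line_poly f p v" 0]
    by (simp add: poly_line_poly deriv_at_def poly_0_coeff_0 coeff_pderiv)
  then show ?thesis
    using DERIV_unique by metis
qed

section \<open>The twisted cubic and its tangent lines\<close>

lemma twisted_cubic_map_eq: "twisted_cubic_map s t = vec4 (s ^ 3) (s ^ 2 * t) (s * t ^ 2) (t ^ 3)"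
  by (simp add: twisted_cubic_map_def vec4_def)

lemma twisted_cubic_map_nth [simp]:
  "twisted_cubic_map s t $ 0 = s ^ 3" "twisted_cubic_map s t $ 1 = s ^ 2 * t"
  "twisted_cubic_map s t $ 2 = s * t ^ 2" "twisted_cubic_map s t $ 3 = t ^ 3"
  by (simp_all add: twisted_cubic_map_eq)

lemma twisted_cubic_map_mem: "(s, t) \<noteq> (0, 0) \<Longrightarrow> twisted_cubic_map s t \<in> twisted_cubic"
  unfolding twisted_cubic_def by (rule CollectI, rule exI[of _ 1], rule exI[of _ s], rule exI[of _ t]) auto

text \<open>
  The density argument used throughout: a polynomial identity need only be checked away from the
  zeros of a non-zero polynomial.
\<close>

lemma complex_poly_eq_0I:
  fixes p q :: "complex poly"
  assumes "q \<noteq> 0" "\<And>z. poly q z \<noteq> 0 \<Longrightarrow> poly p z = 0"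
  shows "p = 0"
proof -
  have "p * q = 0"
    by (rule poly_eqI_complex) (use assms(2) in auto)
  with assms(1) show ?thesis by simp
qed

text \<open>
  The zero vector is not a point of \<open>P\<^sup>3\<close>; equations of the curve vanish there by continuity,
  as the cone over the curve is closed.
\<close>

lemma eval_poly_twisted_cubic_map_eq_0:
  assumes "f \<in> vanishing_ideal twisted_cubic"
  shows "eval_poly f (twisted_cubic_map s t) = 0"
proof -
  have nz: "eval_poly f (twisted_cubic_map s t) = 0" if "(s, t) \<noteq> (0, 0)" for s t
    using assms twisted_cubic_map_mem[OF that] by (simp add: vanishing_ideal_def)
  define P where "P i = (if i = 0 then monom (1 :: complex) 3 else 0)" for i :: 4
  have P: "(\<chi> i. poly (P i) z) = twisted_cubic_map z 0" for z
    by (simp add: vec_4_eq_iff P_def poly_monom)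
  have "curve_poly f P = 0"
    by (rule complex_poly_eq_0I[of "[:0, 1:]"]) (auto simp: P nz)
  then have "poly (curve_poly f P) 0 = 0" by simp
  then have "eval_poly f (twisted_cubic_map 0 0) = 0"
    by (simp only: poly_curve_poly P)
  with nz show ?thesis by (cases "(s, t) = (0, 0)") auto
qed

text \<open>
  The derivative of the parametrisation at \<open>(s, t)\<close> in the direction \<open>(a, b)\<close>.  As \<open>(a, b)\<close> varies, these
  vectors fill the affine plane over one projective tangent line; by Euler's formula it contains the
  point of contact itself.
\<close>

definition tangent_vector :: "complex \<Rightarrow> complex \<Rightarrow> complex \<Rightarrow> complex \<Rightarrow> complex ^ 4" where
  "tangent_vector s t a b =
     vec4 (3 * s ^ 2 * a) (2 * s * t * a + s ^ 2 * b) (t ^ 2 * a + 2 * s * t * b) (3 * t ^ 2 * b)"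

text \<open>
  An equation \<open>f\<close> of the curve is identically zero along \<open>z \<mapsto> \<gamma>(s + z a, t + z b)\<close>, where \<open>\<gamma>\<close> is the
  parametrisation, and so is its derivative at \<open>z = 0\<close>.
\<close>

lemma deriv_at_tangent_vector:
  assumes "f \<in> vanishing_ideal twisted_cubic"
  shows "deriv_at f (twisted_cubic_map s t) (tangent_vector s t a b) = 0"
proof -
  define P where "P i = (if i = 0 then [:s, a:] ^ 3 else if i = 1 then [:s, a:] ^ 2 * [:t, b:]
    else if i = 2 then [:s, a:] * [:t, b:] ^ 2 else [:t, b:] ^ 3)" for i :: 4
  have P: "(\<chi> i. poly (P i) z) = twisted_cubic_map (s + z * a) (t + z * b)" for z
    by (simp add: vec_4_eq_iff P_def algebra_simps)
  have "curve_poly f P = 0"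
    by (rule poly_eqI_complex) (simp add: P eval_poly_twisted_cubic_map_eq_0[OF assms])
  moreover have "(\<chi> i. coeff (P i) 0) = twisted_cubic_map s t"
    using P[of 0] by (simp add: poly_0_coeff_0)
  moreover have "(\<chi> i. coeff (P i) (Suc 0)) = tangent_vector s t a b"
    by (simp add: vec_4_eq_iff P_def tangent_vector_def power2_eq_square power3_eq_cube
        algebra_simps)
  ultimately show ?thesis
    using coeff_curve_poly_1[of f P] by simp
qed

text \<open>
  The 2 by 2 minors of the matrix with rows \<open>x\<^sub>0, x\<^sub>1, x\<^sub>2\<close> and \<open>x\<^sub>1, x\<^sub>2, x\<^sub>3\<close>.  Expanding determinants
  with a repeated row yields the two syzygies \<open>x\<^sub>0 q\<^sub>2 - x\<^sub>1 q\<^sub>1 + x\<^sub>2 q\<^sub>0 = 0\<close> and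
  \<open>x\<^sub>1 q\<^sub>2 - x\<^sub>2 q\<^sub>1 + x\<^sub>3 q\<^sub>0 = 0\<close>, which are used repeatedly below.
\<close>

definition quadric0 :: cpoly4 where "quadric0 = var 0 * var 2 - var 1 * var 1"
definition quadric1 :: cpoly4 where "quadric1 = var 0 * var 3 - var 1 * var 2"
definition quadric2 :: cpoly4 where "quadric2 = var 1 * var 3 - var 2 * var 2"

text \<open>
  The discriminant of \<open>q\<^sub>0 T\<^sup>2 - q\<^sub>1 T + q\<^sub>2\<close>.  For a point off the curve on the secant through the points
  with parameters \<open>a\<close> and \<open>b\<close>, the roots of this polynomial are \<open>a\<close> and \<open>b\<close>; on a tangent line they
  coincide.
\<close>

definition discriminant_quartic :: cpoly4 where
  "discriminant_quartic = quadric1 ^ 2 - 4 * quadric0 * quadric2"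

lemmas quadric_defs = quadric0_def quadric1_def quadric2_def

lemma eval_quadrics [simp]:
  "eval_poly quadric0 v = v $ 0 * v $ 2 - v $ 1 * v $ 1"
  "eval_poly quadric1 v = v $ 0 * v $ 3 - v $ 1 * v $ 2"
  "eval_poly quadric2 v = v $ 1 * v $ 3 - v $ 2 * v $ 2"
  by (simp_all add: quadric_defs)

lemma quadrics_in_vanishing_ideal:
  "quadric0 \<in> vanishing_ideal twisted_cubic"
  "quadric1 \<in> vanishing_ideal twisted_cubic"
  "quadric2 \<in> vanishing_ideal twisted_cubic"
  by (auto simp: vanishing_ideal_def twisted_cubic_def power2_eq_square power3_eq_cube)

lemma eval_discriminant_quartic:
  "eval_poly discriminant_quartic v =
     (v $ 0 * v $ 3 - v $ 1 * v $ 2) ^ 2 - 4 * (v $ 0 * v $ 2 - v $ 1 * v $ 1) * (v $ 1 * v $ 3 - v $ 2 * v $ 2)"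
  by (simp add: discriminant_quartic_def)

lemma eval_discriminant_quartic_tangent_vector:
  "eval_poly discriminant_quartic (tangent_vector s t a b) = 0"
  by (simp add: eval_discriminant_quartic tangent_vector_def) algebra

text \<open>
  If \<open>q\<^sub>0 \<noteq> 0\<close>, the parameter of the point of contact is the double root \<open>q\<^sub>1 / (2 q\<^sub>0)\<close> of
  \<open>q\<^sub>0 T\<^sup>2 - q\<^sub>1 T + q\<^sub>2\<close>, and the syzygies determine the last two coordinates from the first two.  If
  \<open>q\<^sub>0 = 0\<close> and \<open>x\<^sub>0 \<noteq> 0\<close>, the point lies on the curve itself; the remaining points lie on the tangent
  line at \<open>(0, 0, 0, 1)\<close>.
\<close>

lemma discriminant_quartic_zero_imp_tangent_vector:
  assumes "eval_poly discriminant_quartic v = 0"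
  obtains s t a b where "(s, t) \<noteq> (0, 0)" "v = tangent_vector s t a b"
proof -
  define x0 x1 x2 x3 where x: "x0 = v $ 0" "x1 = v $ 1" "x2 = v $ 2" "x3 = v $ 3"
  define q0 q1 q2 where q: "q0 = x0 * x2 - x1 * x1" "q1 = x0 * x3 - x1 * x2" "q2 = x1 * x3 - x2 * x2"
  have disc: "q1 ^ 2 = 4 * q0 * q2"
    using assms by (simp add: eval_discriminant_quartic q x)
  have syzygies: "q0 * x2 = q1 * x1 - q2 * x0" "q0 * x3 = q1 * x2 - q2 * x1"
    by (simp_all add: q algebra_simps)
  consider "q0 \<noteq> 0" | "q0 = 0" "x0 \<noteq> 0" | "q0 = 0" "x0 = 0"
    by blast
  then show ?thesis
  proof cases
    case 1
    define t where "t = q1 / (2 * q0)"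
    have t: "2 * q0 * t = q1"
      using 1 by (simp add: t_def)
    have "q0 * q2 = q0 * (q0 * t ^ 2)"
      using disc unfolding t[symmetric] by (auto simp: algebra_simps power2_eq_square)
    then have q2: "q2 = q0 * t ^ 2"
      using 1 by simp
    have "q0 * x2 = q0 * (2 * t * x1 - t ^ 2 * x0)"
      using syzygies(1) unfolding q2 t[symmetric] by (simp add: algebra_simps)
    then have x2: "x2 = 2 * t * x1 - t ^ 2 * x0"
      using 1 by simp
    have "q0 * x3 = q0 * (2 * t * x2 - t ^ 2 * x1)"
      using syzygies(2) unfolding q2 t[symmetric] by (simp add: algebra_simps)
    then have x3: "x3 = 2 * t * x2 - t ^ 2 * x1"
      using 1 by simp
    have "v = tangent_vector 1 t (x0 / 3) (x1 - 2 * (x0 / 3) * t)"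
      using x2 x3[unfolded x2]
      by (simp add: vec_4_eq_iff tangent_vector_def flip: x) (simp add: field_simps power2_eq_square)
    then show ?thesis
      using that[of 1] by simp
  next
    case 2
    with disc have "q1 = 0" by simp
    with syzygies 2 have "q2 = 0" by simp
    define t where "t = x1 / x0"
    have x1: "x1 = x0 * t"
      using 2 by (simp add: t_def)
    have "x0 * x2 = x0 * (x0 * t ^ 2)"
      using \<open>q0 = 0\<close> by (simp add: q x1 algebra_simps power2_eq_square)
    then have x2: "x2 = x0 * t ^ 2"
      using 2 by simp
    have "x0 * x3 = x0 * (x0 * t ^ 3)"
      using \<open>q1 = 0\<close> by (simp add: q x1 x2 algebra_simps power2_eq_square power3_eq_cube)
    then have x3: "x3 = x0 * t ^ 3"
      using 2 by simp
    have "v = tangent_vector 1 t (x0 / 3) (x0 / 3 * t)"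
      by (simp add: vec_4_eq_iff tangent_vector_def flip: x)
        (simp add: x1 x2 x3 field_simps power2_eq_square power3_eq_cube)
    then show ?thesis
      using that[of 1] by simp
  next
    case 3
    then have "x1 = 0"
      by (simp add: q)
    with 3 have "v = tangent_vector 0 1 x2 (x3 / 3)"
      by (simp add: vec_4_eq_iff tangent_vector_def flip: x)
    then show ?thesis
      using that[of 0 1] by simp
  qed
qed

text \<open>
  The polar equations of the three quadrics at \<open>p\<close> already cut out the tangent line at \<open>p\<close>: where
  \<open>s \<noteq> 0\<close>, they express \<open>v $ 2\<close> and \<open>v $ 3\<close> by \<open>v $ 0\<close> and \<open>v $ 1\<close>.
\<close>

lemma tangent_line_twisted_cubic_subset:
  assumes "p \<in> twisted_cubic" "v \<in> tangent_line twisted_cubic p"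
  shows "eval_poly discriminant_quartic v = 0"
proof -
  obtain c s t where p: "p = c *s twisted_cubic_map s t" "c \<noteq> 0" "(s, t) \<noteq> (0, 0)"
    using assms(1) by (auto simp: twisted_cubic_def)
  have "deriv_at q p v = 0" if "q \<in> vanishing_ideal twisted_cubic" for q
    using assms(2) that by (simp add: tangent_line_def has_field_derivative_0_iff_deriv_at)
  from this[OF quadrics_in_vanishing_ideal(1)] this[OF quadrics_in_vanishing_ideal(2)]
    this[OF quadrics_in_vanishing_ideal(3)]
  have polar: "c * (s ^ 3 * v $ 2 + s * t ^ 2 * v $ 0 - 2 * s ^ 2 * t * v $ 1) = 0"
    "c * (s ^ 3 * v $ 3 + t ^ 3 * v $ 0 - s ^ 2 * t * v $ 2 - s * t ^ 2 * v $ 1) = 0"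
    "c * (s ^ 2 * t * v $ 3 + t ^ 3 * v $ 1 - 2 * s * t ^ 2 * v $ 2) = 0"
    by (simp_all add: p(1) quadric_defs algebra_simps)
  note polar = polar[unfolded mult_eq_0_iff[of c] de_Morgan_disj, simplified p(2), simplified]
  show ?thesis
  proof (cases "s = 0")
    case True
    with polar p(3) have "v $ 0 = 0" "v $ 1 = 0" by auto
    then show ?thesis
      by (simp add: eval_discriminant_quartic)
  next
    case False
    define r where "r = t / s"
    have t: "t = r * s"
      using False by (simp add: r_def)
    have "s ^ 3 * (v $ 2 - (2 * r * v $ 1 - r ^ 2 * v $ 0)) = 0"
      using polar(1) unfolding t by (simp add: algebra_simps power2_eq_square power3_eq_cube)
    then have v2: "v $ 2 = 2 * r * v $ 1 - r ^ 2 * v $ 0"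
      using False by simp
    have "s ^ 3 * (v $ 3 - (r * v $ 2 + r ^ 2 * v $ 1 - r ^ 3 * v $ 0)) = 0"
      using polar(2) unfolding t by (simp add: algebra_simps power2_eq_square power3_eq_cube)
    then have v3: "v $ 3 = r * v $ 2 + r ^ 2 * v $ 1 - r ^ 3 * v $ 0"
      using False by simp
    show ?thesis
      unfolding eval_discriminant_quartic v3 v2 by algebra
  qed
qed

theorem zero_locus_discriminant_quartic:
  "zero_locus discriminant_quartic = tangential_developable twisted_cubic"
proof (intro equalityI subsetI)
  fix v assume "v \<in> zero_locus discriminant_quartic"
  then have v: "v \<noteq> 0" "eval_poly discriminant_quartic v = 0"
    by (auto simp: zero_locus_def)
  then obtain s t a b where st: "(s, t) \<noteq> (0, 0)" "v = tangent_vector s t a b"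
    using discriminant_quartic_zero_imp_tangent_vector by blast
  then have "v \<in> tangent_line twisted_cubic (twisted_cubic_map s t)"
    using v(1) by (simp add: tangent_line_def has_field_derivative_0_iff_deriv_at deriv_at_tangent_vector)
  then show "v \<in> tangential_developable twisted_cubic"
    unfolding tangential_developable_def using twisted_cubic_map_mem[OF st(1)] by blast
next
  fix v assume "v \<in> tangential_developable twisted_cubic"
  then show "v \<in> zero_locus discriminant_quartic"
    using tangent_line_twisted_cubic_subset
    by (auto simp: tangential_developable_def zero_locus_def tangent_line_def)
qed

section \<open>Irreducibility of the discriminant\<close>

text \<open>
  Where \<open>x\<^sub>0\<close> and \<open>q\<^sub>0\<close> are non-zero, the discriminant quartic is a quadratic polynomial in \<open>x\<^sub>3\<close> with two
  simple roots.  If the factor \<open>A\<close> vanishes at both, it takes up the whole degree in \<open>x\<^sub>3\<close> and leaves a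
  constant for \<open>B\<close>.  Stating this for functions of four arguments lets the reversal of the
  coordinates, which preserves the discriminant, give the same result for \<open>x\<^sub>0\<close>.
\<close>

lemma cofactor_constant_in_last_variable:
  fixes A B :: "complex \<Rightarrow> complex \<Rightarrow> complex \<Rightarrow> complex \<Rightarrow> complex"
  assumes polyA: "\<And>p q r s. \<exists>Q. \<forall>z. poly Q z = A (poly p z) (poly q z) (poly r z) (poly s z)"
    and polyB: "\<And>p q r s. \<exists>Q. \<forall>z. poly Q z = B (poly p z) (poly q z) (poly r z) (poly s z)"
    and AB: "\<And>x0 x1 x2 x3. A x0 x1 x2 x3 * B x0 x1 x2 x3 =
        (x0 * x3 - x1 * x2) ^ 2 - 4 * (x0 * x2 - x1 * x1) * (x1 * x3 - x2 * x2)"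
    and vanish: "\<And>x0 x1 x2 x3. A x0 x1 x2 x3 * B x0 x1 x2 x3 = 0 \<Longrightarrow> A x0 x1 x2 x3 = 0"
  shows "B x0 x1 x2 x3 = B x0 x1 x2 y"
proof -
  have generic: "B x0 x1 x2 x3 = B x0 x1 x2 y" if nz: "x0 \<noteq> 0" "x0 * x2 - x1 * x1 \<noteq> 0" for x0 x1 x2 x3 y
  proof -
    obtain P where P: "poly P z = A x0 x1 x2 z" for z
      using polyA[of "[:x0:]" "[:x1:]" "[:x2:]" "[:0, 1:]"] by auto
    obtain Q where Q: "poly Q z = B x0 x1 x2 z" for z
      using polyB[of "[:x0:]" "[:x1:]" "[:x2:]" "[:0, 1:]"] by auto
    define b c where "b = 4 * x1 ^ 3 - 6 * x0 * x1 * x2" and "c = 4 * x0 * x2 ^ 3 - 3 * x1 ^ 2 * x2 ^ 2"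
    have PQ: "P * Q = [:c, b, x0 ^ 2:]"
      by (rule poly_eqI_complex) (simp add: P Q AB b_def c_def algebra_simps power2_eq_square power3_eq_cube)
    define w where "w = csqrt (b ^ 2 - 4 * x0 ^ 2 * c)"
    have w2: "w ^ 2 = b ^ 2 - 4 * x0 ^ 2 * c"
      by (simp add: w_def)
    \<comment> \<open>The discriminant of the quartic as a quadratic polynomial in \<open>x\<^sub>3\<close> is a multiple of \<open>q\<^sub>0\<^sup>3\<close>.\<close>
    also have "\<dots> = - 16 * (x0 * x2 - x1 * x1) ^ 3"
      unfolding b_def c_def by algebra
    finally have "w \<noteq> 0"
      using nz by auto
    define r where "r e = (- b + e * w) / (2 * x0 ^ 2)" for e
    have root: "poly P (r e) = 0" if "e ^ 2 = 1" for e
    proof -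
      have r: "2 * x0 ^ 2 * r e = - b + e * w"
        using nz by (simp add: r_def)
      have "4 * x0 ^ 2 * poly (P * Q) (r e) = (2 * x0 ^ 2 * r e + b) ^ 2 - (b ^ 2 - 4 * x0 ^ 2 * c)"
        unfolding PQ by (simp add: algebra_simps power2_eq_square)
      also have "\<dots> = 0"
        unfolding r w2[symmetric] using that by (simp add: power_mult_distrib)
      finally have "poly P (r e) * poly Q (r e) = 0"
        using nz by simp
      then show ?thesis
        using vanish[of x0 x1 x2 "r e"] by (simp add: P Q)
    qed
    have "r 1 \<noteq> r (- 1)"
      using \<open>w \<noteq> 0\<close> nz by (simp add: r_def)
    have PQ_nz: "P * Q \<noteq> 0"
      using nz by (simp add: PQ)
    then have "P \<noteq> 0" "Q \<noteq> 0" by auto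
    have "2 = card {r 1, r (- 1)}"
      using \<open>r 1 \<noteq> r (- 1)\<close> by simp
    also have "\<dots> \<le> card {z. poly P z = 0}"
      by (rule card_mono) (auto simp: root poly_roots_finite[OF \<open>P \<noteq> 0\<close>])
    also have "\<dots> \<le> degree P"
      by (rule card_poly_roots_bound[OF \<open>P \<noteq> 0\<close>])
    finally have "2 \<le> degree P" .
    moreover have "degree P + degree Q = 2"
      using degree_mult_eq[OF \<open>P \<noteq> 0\<close> \<open>Q \<noteq> 0\<close>] nz by (simp add: PQ)
    ultimately have "degree Q = 0" by simp
    then obtain k where "Q = [:k:]"
      by (rule degree_eq_zeroE)
    then show ?thesis
      using Q[of x3] Q[of y] by simp
  qed
  \<comment> \<open>Every point is a limit of points of the generic kind.\<close>
  obtain P where P: "poly P z = B (x0 + z) x1 (x2 + z) x3" for z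
    using polyB[of "[:x0, 1:]" "[:x1:]" "[:x2, 1:]" "[:x3:]"] by auto
  obtain Q where Q: "poly Q z = B (x0 + z) x1 (x2 + z) y" for z
    using polyB[of "[:x0, 1:]" "[:x1:]" "[:x2, 1:]" "[:y:]"] by auto
  have "P - Q = 0"
  proof (rule complex_poly_eq_0I)
    show "[:x0, 1:] * [:x0 * x2 - x1 * x1, x0 + x2, 1:] \<noteq> 0"
      by simp
    fix z assume "poly ([:x0, 1:] * [:x0 * x2 - x1 * x1, x0 + x2, 1:]) z \<noteq> 0"
    moreover have "poly ([:x0, 1:] * [:x0 * x2 - x1 * x1, x0 + x2, 1:]) z
        = (x0 + z) * ((x0 + z) * (x2 + z) - x1 * x1)"
      by (simp add: algebra_simps)
    ultimately have "x0 + z \<noteq> 0" "(x0 + z) * (x2 + z) - x1 * x1 \<noteq> 0"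
      by auto
    from generic[OF this] show "poly (P - Q) z = 0"
      by (simp add: P Q)
  qed
  then have "poly P 0 = poly Q 0" by simp
  then show ?thesis
    by (simp add: P Q)
qed

lemma eval_poly_restricts_to_poly:
  "\<exists>Q. \<forall>z. poly Q z = eval_poly f (vec4 (poly p z) (poly q z) (poly r z) (poly s z))"
proof -
  define P where "P i = (if i = 0 then p else if i = 1 then q else if i = 2 then r else s)" for i :: 4
  have "(\<chi> i. poly (P i) z) = vec4 (poly p z) (poly q z) (poly r z) (poly s z)" for z
    by (simp add: vec_4_eq_iff P_def)
  then have "poly (curve_poly f P) z = eval_poly f (vec4 (poly p z) (poly q z) (poly r z) (poly s z))" for z
    by simp
  then show ?thesis by blast
qed

text \<open>
  The cone over the developable is the image of \<open>C\<^sup>4\<close> under a polynomial map.  If neither factor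
  vanished on it, neither would vanish on the image of a suitable line in \<open>C\<^sup>4\<close>, although the product does.
\<close>

lemma factor_vanishes_on_developable:
  assumes "discriminant_quartic = A * B"
  shows "(\<forall>v. eval_poly discriminant_quartic v = 0 \<longrightarrow> eval_poly A v = 0) \<or>
    (\<forall>v. eval_poly discriminant_quartic v = 0 \<longrightarrow> eval_poly B v = 0)"
proof (rule ccontr)
  assume "\<not> ?thesis"
  then obtain v w where v: "eval_poly discriminant_quartic v = 0" "eval_poly A v \<noteq> 0"
    and w: "eval_poly discriminant_quartic w = 0" "eval_poly B w \<noteq> 0"
    by blast
  obtain s t a b where v_eq: "v = tangent_vector s t a b"
    by (rule discriminant_quartic_zero_imp_tangent_vector[OF v(1)])
  obtain s' t' a' b' where w_eq: "w = tangent_vector s' t' a' b'"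
    by (rule discriminant_quartic_zero_imp_tangent_vector[OF w(1)])
  define S T X Y where "S = [:s, s' - s:]" "T = [:t, t' - t:]" "X = [:a, a' - a:]" "Y = [:b, b' - b:]"
  note STXY = this
  define u where "u z = tangent_vector (poly S z) (poly T z) (poly X z) (poly Y z)" for z
  have "\<exists>Q. \<forall>z. poly Q z = eval_poly f (u z)" for f
    unfolding u_def tangent_vector_def
    using eval_poly_restricts_to_poly[of f "3 * S ^ 2 * X" "2 * S * T * X + S ^ 2 * Y"
        "T ^ 2 * X + 2 * S * T * Y" "3 * T ^ 2 * Y"]
    by (simp only: poly_mult poly_add poly_power poly_numeral)
  then obtain P Q where PQ: "\<And>z. poly P z = eval_poly A (u z)" "\<And>z. poly Q z = eval_poly B (u z)"
    by metis
  have "P * Q = 0"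
  proof (rule poly_eqI_complex)
    fix z
    have "poly (P * Q) z = eval_poly discriminant_quartic (u z)"
      by (simp add: PQ assms)
    then show "poly (P * Q) z = poly 0 z"
      by (simp add: u_def eval_discriminant_quartic_tangent_vector)
  qed
  moreover have "u 0 = v" "u 1 = w"
    by (simp_all add: u_def STXY v_eq w_eq)
  ultimately show False
    using v(2) w(2) PQ(1)[of 0] PQ(2)[of 1] by auto
qed

text \<open>
  By the fundamental theorem of algebra, a polynomial without zeros is constant on every line through
  the origin.
\<close>

lemma nowhere_zero_imp_unit:
  assumes "\<And>v. eval_poly f v \<noteq> 0"
  shows "f dvd 1"
proof -
  have "eval_poly f v = eval_poly f 0" for v
  proof -
    have "constant (poly (line_poly f 0 v))"
      using fundamental_theorem_of_algebra[of "line_poly f 0 v"] assms by (auto simp: poly_line_poly)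
    then have "poly (line_poly f 0 v) 1 = poly (line_poly f 0 v) 0"
      unfolding constant_def by blast
    then show ?thesis
      by (simp add: poly_line_poly)
  qed
  then have "f * const_poly (1 / eval_poly f 0) = 1"
    by (intro eval_poly_eqI) (simp add: assms)
  then show ?thesis
    by (metis dvd_triv_left)
qed

text \<open>
  A cofactor \<open>B\<close> that depends neither on \<open>x\<^sub>3\<close> nor on \<open>x\<^sub>0\<close> has no zeros: by moving in these two directions
  one leaves the zero set of the quartic from any point.
\<close>

lemma cofactor_is_unit:
  assumes AB: "discriminant_quartic = A * B"
    and vanish: "\<And>v. eval_poly discriminant_quartic v = 0 \<Longrightarrow> eval_poly A v = 0"
  shows "B dvd 1"
proof (rule nowhere_zero_imp_unit)
  fix v :: "complex ^ 4"
  have AB': "eval_poly A v * eval_poly B v = eval_poly discriminant_quartic v" for v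
    by (simp add: AB)
  have x3: "eval_poly B (vec4 x0 x1 x2 x3) = eval_poly B (vec4 x0 x1 x2 y)" for x0 x1 x2 x3 y
    by (rule cofactor_constant_in_last_variable[where A = "\<lambda>x0 x1 x2 x3. eval_poly A (vec4 x0 x1 x2 x3)"])
      (simp_all only: eval_poly_restricts_to_poly AB' vanish, simp add: eval_discriminant_quartic)
  have x0: "eval_poly B (vec4 x0 x1 x2 x3) = eval_poly B (vec4 y x1 x2 x3)" for x0 x1 x2 x3 y
    by (rule cofactor_constant_in_last_variable[where A = "\<lambda>x3 x2 x1 x0. eval_poly A (vec4 x0 x1 x2 x3)"
          and B = "\<lambda>x3 x2 x1 x0. eval_poly B (vec4 x0 x1 x2 x3)"])
      (simp_all only: eval_poly_restricts_to_poly AB' vanish, simp add: eval_discriminant_quartic algebra_simps)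
  define D where "D y = eval_poly discriminant_quartic (vec4 1 (v $ 1) (v $ 2) y)" for y
  \<comment> \<open>The second difference of a monic quadratic polynomial is \<open>2\<close>, so it has a non-zero value.\<close>
  have "D 1 + D (- 1) - 2 * D 0 = 2"
    by (simp add: D_def eval_discriminant_quartic algebra_simps power2_eq_square)
  then obtain y where "D y \<noteq> 0"
    by (metis add.right_neutral diff_0_right mult_zero_right zero_neq_numeral)
  then have "eval_poly B (vec4 1 (v $ 1) (v $ 2) y) \<noteq> 0"
    unfolding D_def AB by auto
  also have "eval_poly B (vec4 1 (v $ 1) (v $ 2) y) = eval_poly B v"
    using x3[of 1 "v $ 1" "v $ 2" y "v $ 3"] x0[of 1 "v $ 1" "v $ 2" "v $ 3" "v $ 0"]
    by (simp add: vec4_collapse)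
  finally show "eval_poly B v \<noteq> 0" .
qed

theorem irreducible_discriminant_quartic: "irreducible discriminant_quartic"
proof (rule irreducibleI)
  have "eval_poly discriminant_quartic (vec4 1 0 0 1) = 1"
    by (simp add: eval_discriminant_quartic)
  then show "discriminant_quartic \<noteq> 0" by auto
  show "\<not> discriminant_quartic dvd 1"
  proof
    assume "discriminant_quartic dvd 1"
    then obtain g where "1 = discriminant_quartic * g" ..
    then have "eval_poly 1 0 = eval_poly (discriminant_quartic * g) 0" by simp
    then show False by (simp add: eval_discriminant_quartic)
  qed
next
  fix A B assume "discriminant_quartic = A * B"
  with factor_vanishes_on_developable[OF this] cofactor_is_unit[of A B] cofactor_is_unit[of B A]
  show "A dvd 1 \<or> B dvd 1"
    by (auto simp: mult.commute)
qed

section \<open>The discriminant is cuspidal along the twisted cubic\<close>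

lemma module_cpoly4: "module ((*) :: cpoly4 \<Rightarrow> cpoly4 \<Rightarrow> cpoly4)"
  by unfold_locales (simp_all add: algebra_simps)

lemma ideal_generated_0: "0 \<in> ideal_generated S"
  unfolding ideal_generated_def by (rule module.span_zero[OF module_cpoly4])

lemma ideal_generated_base: "f \<in> S \<Longrightarrow> f \<in> ideal_generated S"
  unfolding ideal_generated_def by (rule module.span_base[OF module_cpoly4])

lemma ideal_generated_add:
  "f \<in> ideal_generated S \<Longrightarrow> g \<in> ideal_generated S \<Longrightarrow> f + g \<in> ideal_generated S"
  unfolding ideal_generated_def by (rule module.span_add[OF module_cpoly4])

lemma ideal_generated_induct [consumes 1, case_names base zero add mult]:
  assumes "f \<in> ideal_generated S"
    and "\<And>f. f \<in> S \<Longrightarrow> P f" "P 0" "\<And>f g. P f \<Longrightarrow> P g \<Longrightarrow> P (f + g)" "\<And>r f. P f \<Longrightarrow> P (r * f)"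
  shows "P f"
  using assms(1) unfolding ideal_generated_def
  by (rule module.span_induct[OF module_cpoly4])
    (use assms(2-) in \<open>auto simp: module.subspace_def[OF module_cpoly4]\<close>)

lemma homogeneous_quadrics [simp]:
  "homogeneous 2 quadric0" "homogeneous 2 quadric1" "homogeneous 2 quadric2"
  unfolding quadric_defs
  by (auto intro!: homogeneous_diff homogeneous_mult_eq[OF homogeneous_var homogeneous_var])

lemma homogeneous_discriminant_quartic: "homogeneous 4 discriminant_quartic"
  unfolding discriminant_quartic_def
  by (intro homogeneous_diff homogeneous_power_eq[OF homogeneous_quadrics(2)]
      homogeneous_mult_eq[OF homogeneous_numeral_mult[OF homogeneous_quadrics(1)] homogeneous_quadrics(3)])
    auto

lemma double_curve_discriminant_quartic: "double_curve twisted_cubic 4 discriminant_quartic"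
proof -
  let ?I = "vanishing_ideal twisted_cubic"
  have "- (4 * quadric0) \<in> ?I"
    using quadrics_in_vanishing_ideal(1) by (simp add: vanishing_ideal_def)
  then have "- (4 * quadric0) * quadric2 \<in> ideal_square ?I" "quadric1 * quadric1 \<in> ideal_square ?I"
    unfolding ideal_square_def using quadrics_in_vanishing_ideal
    by (blast intro: ideal_generated_base)+
  then have "quadric1 * quadric1 + - (4 * quadric0) * quadric2 \<in> ideal_square ?I"
    unfolding ideal_square_def by (blast intro: ideal_generated_add)
  then have "1 * discriminant_quartic \<in> ideal_square ?I"
    by (simp add: discriminant_quartic_def power2_eq_square)
  then show ?thesis
    unfolding double_curve_def using homogeneous_discriminant_quartic
    by (metis eval_poly_1 homogeneous_1 zero_neq_one)
qed

text \<open>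
  Suppose that, modulo \<open>f\<close> and \<open>g\<close>, multiplication by \<open>h\<^sup>2\<close> turns the coordinates into cubic forms \<open>\<rho>\<close>
  that parametrise the curve.  Then a power of \<open>h\<close> turns any form \<open>u\<close> into its pullback along this
  parametrisation, which is zero for an equation \<open>u\<close> of the curve.  Hence \<open>f\<close> and \<open>g\<close> generate
  the whole ideal where \<open>h\<close> does not vanish.
\<close>

lemma chart_reduction:
  assumes h: "homogeneous 1 h"
    and coord: "\<And>i. homogeneous 1 (\<alpha> i) \<and> homogeneous 1 (\<beta> i) \<and> homogeneous 3 (\<rho> i) \<and>
        h ^ 2 * var i = \<alpha> i * f + \<beta> i * g + \<rho> i"
    and u: "homogeneous e u"
  shows "\<exists>a b r. homogeneous (3 * e) a \<and> homogeneous (3 * e) b \<and>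
    h ^ (2 * e + 2) * u = a * f + b * g + r \<and>
    (\<forall>v. eval_poly r v = eval_poly h v ^ 2 * eval_poly u (\<chi> i. eval_poly (\<rho> i) v))"
  using u
proof (induction rule: homogeneous_induct)
  case (zero e)
  show ?case
    by (intro exI[of _ 0]) simp
next
  case (const c)
  show ?case
    by (rule exI[of _ 0], rule exI[of _ 0], rule exI[of _ "h ^ 2 * const_poly c"])
      (simp add: power2_eq_square)
next
  case (mult_var e i u)
  then obtain a b r where abr: "homogeneous (3 * e) a" "homogeneous (3 * e) b"
    "h ^ (2 * e + 2) * u = a * f + b * g + r"
    "\<And>v. eval_poly r v = eval_poly h v ^ 2 * eval_poly u (\<chi> i. eval_poly (\<rho> i) v)"
    by blast
  let ?hu = "h ^ (2 * e + 2) * u"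
  have hu: "homogeneous (3 * e + 2) ?hu"
    by (rule homogeneous_mult_eq[OF homogeneous_power[OF h] mult_var(1)]) simp
  have "h ^ (2 * Suc e + 2) * (var i * u) = (h ^ 2 * var i) * ?hu"
    by (simp add: power_add power2_eq_square algebra_simps)
  also have "\<dots> = (\<alpha> i * f + \<beta> i * g + \<rho> i) * ?hu"
    using coord[of i] by simp
  also have "\<dots> = (\<alpha> i * f + \<beta> i * g) * ?hu + \<rho> i * (a * f + b * g + r)"
    using abr(3) by (simp add: algebra_simps)
  also have "\<dots> = (\<alpha> i * ?hu + \<rho> i * a) * f + (\<beta> i * ?hu + \<rho> i * b) * g + \<rho> i * r"
    by (simp add: algebra_simps)
  finally have "h ^ (2 * Suc e + 2) * (var i * u) = \<dots>" .
  moreover have "homogeneous (3 * Suc e) (\<alpha> i * ?hu + \<rho> i * a)"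
    "homogeneous (3 * Suc e) (\<beta> i * ?hu + \<rho> i * b)"
    using coord[of i] hu abr(1,2) by (auto intro!: homogeneous_add elim!: homogeneous_mult_eq)
  moreover have "eval_poly (\<rho> i * r) v =
      eval_poly h v ^ 2 * eval_poly (var i * u) (\<chi> i. eval_poly (\<rho> i) v)" for v
    by (simp add: abr(4))
  ultimately show ?case by blast
next
  case (add e u v)
  then obtain a b r a' b' r' where
    "homogeneous (3 * e) a" "homogeneous (3 * e) b" "h ^ (2 * e + 2) * u = a * f + b * g + r"
    "\<And>w. eval_poly r w = eval_poly h w ^ 2 * eval_poly u (\<chi> i. eval_poly (\<rho> i) w)"
    "homogeneous (3 * e) a'" "homogeneous (3 * e) b'" "h ^ (2 * e + 2) * v = a' * f + b' * g + r'"
    "\<And>w. eval_poly r' w = eval_poly h w ^ 2 * eval_poly v (\<chi> i. eval_poly (\<rho> i) w)"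
    by blast
  then show ?case
    by (intro exI[of _ "a + a'"] exI[of _ "b + b'"] exI[of _ "r + r'"])
      (simp add: homogeneous_add algebra_simps)
qed

lemma conormal_frame_if_chart_reduction:
  assumes h: "homogeneous 1 h" "eval_poly h p \<noteq> 0"
    and coord: "\<forall>i. homogeneous 1 (\<alpha> i) \<and> homogeneous 1 (\<beta> i) \<and> homogeneous 3 (\<rho> i) \<and>
        h ^ 2 * var i = \<alpha> i * f + \<beta> i * g + \<rho> i"
    and param: "\<And>v. \<exists>s t. (\<chi> i. eval_poly (\<rho> i) v) = twisted_cubic_map s t"
    and fg: "homogeneous 2 f" "homogeneous 2 g"
      "f \<in> vanishing_ideal twisted_cubic" "g \<in> vanishing_ideal twisted_cubic"
  shows "conormal_frame twisted_cubic p 2 f g"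
  unfolding conormal_frame_def
proof (intro conjI allI impI fg)
  fix e u assume u: "u \<in> vanishing_ideal twisted_cubic \<and> homogeneous e u"
  then obtain a b r where abr: "homogeneous (3 * e) a" "homogeneous (3 * e) b"
    "h ^ (2 * e + 2) * u = a * f + b * g + r"
    "\<And>v. eval_poly r v = eval_poly h v ^ 2 * eval_poly u (\<chi> i. eval_poly (\<rho> i) v)"
    using chart_reduction[OF h(1) spec[OF coord], of e u] by blast
  have "r = 0"
  proof (rule eval_poly_eq_0_imp)
    fix v
    obtain s t where "(\<chi> i. eval_poly (\<rho> i) v) = twisted_cubic_map s t"
      using param by blast
    then show "eval_poly r v = 0"
      using u by (simp add: abr(4) eval_poly_twisted_cubic_map_eq_0)
  qed
  then have "h ^ (2 * e + 2) * u - (a * f + b * g) \<in> ideal_square (vanishing_ideal twisted_cubic)"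
    using abr(3) by (simp add: ideal_square_def ideal_generated_0)
  moreover have "homogeneous (2 * e + 2) (h ^ (2 * e + 2))"
    using homogeneous_power[OF h(1), of "2 * e + 2"] by simp
  ultimately show "\<exists>k l h a b. homogeneous k h \<and> eval_poly h p \<noteq> 0 \<and>
      homogeneous l a \<and> homogeneous l b \<and> k + e = l + 2 \<and>
      h * u - (a * f + b * g) \<in> ideal_square (vanishing_ideal twisted_cubic)"
    using abr(1,2) h(2)
    by (intro exI[of _ "2 * e + 2"] exI[of _ "3 * e"] exI[of _ "h ^ (2 * e + 2)"] exI[of _ a] exI[of _ b])
      simp
qed

lemma homogeneous_var_1 [simp]: "homogeneous 1 (var i)"
  by simp

lemma homogeneous_cubic_monomial [simp]: "homogeneous 3 (var i * var j * var k)"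
  by (rule homogeneous_mult_eq[OF homogeneous_mult[OF homogeneous_var homogeneous_var] homogeneous_var]) simp

text \<open>
  Where \<open>x\<^sub>0 \<noteq> 0\<close> the first syzygy makes \<open>q\<^sub>2\<close> redundant, and the curve is parametrised by \<open>x\<^sub>0\<close> and \<open>x\<^sub>1\<close>.
  Where \<open>x\<^sub>3 \<noteq> 0\<close> the second one makes \<open>q\<^sub>0\<close> redundant, and \<open>x\<^sub>2\<close> and \<open>x\<^sub>3\<close> serve as parameters.
\<close>

lemma conormal_frame_01:
  assumes "p $ 0 \<noteq> 0"
  shows "conormal_frame twisted_cubic p 2 quadric0 quadric1"
proof -
  define \<alpha> \<beta> \<rho> where "\<alpha> i = (if i = 2 then var 0 else if i = 3 then var 1 else 0)"
    and "\<beta> i = (if i = 3 then var 0 else 0)"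
    and "\<rho> i = (if i = 0 then var 0 * var 0 * var 0 else if i = 1 then var 0 * var 0 * var 1
      else if i = 2 then var 0 * var 1 * var 1 else var 1 * var 1 * var 1)" for i :: 4
  note coeffs = this
  have hom: "\<forall>i. homogeneous 1 (\<alpha> i) \<and> homogeneous 1 (\<beta> i) \<and> homogeneous 3 (\<rho> i)"
    by (simp add: coeffs)
  have "\<forall>i. var 0 ^ 2 * var i = \<alpha> i * quadric0 + \<beta> i * quadric1 + \<rho> i"
    unfolding forall_4_from_0 by (simp add: coeffs quadric_defs power2_eq_square algebra_simps)
  with hom have coord: "\<forall>i. homogeneous 1 (\<alpha> i) \<and> homogeneous 1 (\<beta> i) \<and> homogeneous 3 (\<rho> i) \<and>
      var 0 ^ 2 * var i = \<alpha> i * quadric0 + \<beta> i * quadric1 + \<rho> i"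
    by blast
  have "(\<chi> i. eval_poly (\<rho> i) v) = twisted_cubic_map (v $ 0) (v $ 1)" for v
    by (simp add: vec_4_eq_iff coeffs power2_eq_square power3_eq_cube)
  then have param: "\<exists>s t. (\<chi> i. eval_poly (\<rho> i) v) = twisted_cubic_map s t" for v
    by blast
  show ?thesis
    by (rule conormal_frame_if_chart_reduction[OF _ _ coord param])
      (use assms in \<open>simp_all add: quadrics_in_vanishing_ideal\<close>)
qed

lemma conormal_frame_21:
  assumes "p $ 3 \<noteq> 0"
  shows "conormal_frame twisted_cubic p 2 quadric2 quadric1"
proof -
  define \<alpha> \<beta> \<rho> where "\<alpha> i = (if i = 0 then var 2 else if i = 1 then var 3 else 0)"
    and "\<beta> i = (if i = 0 then var 3 else 0)"
    and "\<rho> i = (if i = 0 then var 2 * var 2 * var 2 else if i = 1 then var 2 * var 2 * var 3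
      else if i = 2 then var 2 * var 3 * var 3 else var 3 * var 3 * var 3)" for i :: 4
  note coeffs = this
  have hom: "\<forall>i. homogeneous 1 (\<alpha> i) \<and> homogeneous 1 (\<beta> i) \<and> homogeneous 3 (\<rho> i)"
    by (simp add: coeffs)
  have "\<forall>i. var 3 ^ 2 * var i = \<alpha> i * quadric2 + \<beta> i * quadric1 + \<rho> i"
    unfolding forall_4_from_0 by (simp add: coeffs quadric_defs power2_eq_square algebra_simps)
  with hom have coord: "\<forall>i. homogeneous 1 (\<alpha> i) \<and> homogeneous 1 (\<beta> i) \<and> homogeneous 3 (\<rho> i) \<and>
      var 3 ^ 2 * var i = \<alpha> i * quadric2 + \<beta> i * quadric1 + \<rho> i"
    by blast
  have "(\<chi> i. eval_poly (\<rho> i) v) = twisted_cubic_map (v $ 2) (v $ 3)" for v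
    by (simp add: vec_4_eq_iff coeffs power2_eq_square power3_eq_cube)
  then have param: "\<exists>s t. (\<chi> i. eval_poly (\<rho> i) v) = twisted_cubic_map s t" for v
    by blast
  show ?thesis
    by (rule conormal_frame_if_chart_reduction[OF _ _ coord param])
      (use assms in \<open>simp_all add: quadrics_in_vanishing_ideal\<close>)
qed

lemma induced_form_discriminant_quartic:
  assumes "homogeneous 1 h" "homogeneous 1 a" "homogeneous 1 b" "homogeneous 1 c" "eval_poly h p \<noteq> 0"
    and "h * discriminant_quartic = a * f ^ 2 + b * f * g + c * g ^ 2"
  shows "induced_form twisted_cubic 4 discriminant_quartic p 2 f g
    (eval_poly a p / eval_poly h p) (eval_poly b p / eval_poly h p) (eval_poly c p / eval_poly h p)"
  unfolding induced_form_def
  by (intro exI[of _ 1] exI[of _ h] exI[of _ a] exI[of _ b] exI[of _ c])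
    (simp add: assms[simplified] ideal_cube_def ideal_generated_0)

text \<open>
  By the syzygies, \<open>x\<^sub>0 (q\<^sub>1\<^sup>2 - 4 q\<^sub>0 q\<^sub>2) = 4 x\<^sub>2 q\<^sub>0\<^sup>2 - 4 x\<^sub>1 q\<^sub>0 q\<^sub>1 + x\<^sub>0 q\<^sub>1\<^sup>2\<close>, whose discriminant as a
  binary form in \<open>q\<^sub>0\<close> and \<open>q\<^sub>1\<close> is \<open>-16 q\<^sub>0\<close>, which is zero along the curve.  The other chart is the same
  with the coordinates reversed.
\<close>

theorem cuspidal_curve_discriminant_quartic: "cuspidal_curve twisted_cubic 4 discriminant_quartic"
  unfolding cuspidal_curve_def
proof (intro conjI double_curve_discriminant_quartic ballI)
  fix p assume p: "p \<in> twisted_cubic"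
  then have q: "p $ 1 * p $ 1 = p $ 0 * p $ 2" "p $ 2 * p $ 2 = p $ 1 * p $ 3"
    by (auto simp: twisted_cubic_def power2_eq_square power3_eq_cube)
  have hom: "homogeneous 1 (4 * var i)" for i
    by (rule homogeneous_numeral_mult) simp
  consider "p $ 0 \<noteq> 0" | "p $ 3 \<noteq> 0"
    using p by (auto simp: twisted_cubic_def)
  then show "pinch_point twisted_cubic 4 discriminant_quartic p"
  proof cases
    case 1
    have "induced_form twisted_cubic 4 discriminant_quartic p 2 quadric0 quadric1
      (eval_poly (4 * var 2) p / eval_poly (var 0) p) (eval_poly (- (4 * var 1)) p / eval_poly (var 0) p)
      (eval_poly (var 0) p / eval_poly (var 0) p)"
      by (rule induced_form_discriminant_quartic[OF homogeneous_var_1 hom homogeneous_uminus[OF hom] homogeneous_var_1])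
        (use 1 in \<open>simp_all add: discriminant_quartic_def quadric_defs algebra_simps power2_eq_square\<close>)
    moreover have "(eval_poly (- (4 * var 1)) p / eval_poly (var 0) p) ^ 2 -
      4 * (eval_poly (4 * var 2) p / eval_poly (var 0) p) * (eval_poly (var 0) p / eval_poly (var 0) p) = 0"
      using 1 q by (simp add: field_simps power2_eq_square)
    ultimately show ?thesis
      unfolding pinch_point_def using conormal_frame_01[OF 1] p by blast
  next
    case 2
    have "induced_form twisted_cubic 4 discriminant_quartic p 2 quadric2 quadric1
      (eval_poly (4 * var 1) p / eval_poly (var 3) p) (eval_poly (- (4 * var 2)) p / eval_poly (var 3) p)
      (eval_poly (var 3) p / eval_poly (var 3) p)"
      by (rule induced_form_discriminant_quartic[OF homogeneous_var_1 hom homogeneous_uminus[OF hom] homogeneous_var_1])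
        (use 2 in \<open>simp_all add: discriminant_quartic_def quadric_defs algebra_simps power2_eq_square\<close>)
    moreover have "(eval_poly (- (4 * var 2)) p / eval_poly (var 3) p) ^ 2 -
      4 * (eval_poly (4 * var 1) p / eval_poly (var 3) p) * (eval_poly (var 3) p / eval_poly (var 3) p) = 0"
      using 2 q by (simp add: field_simps power2_eq_square)
    ultimately show ?thesis
      unfolding pinch_point_def using conormal_frame_21[OF 2] p by blast
  qed
qed

section \<open>Quartics that are cuspidal along the twisted cubic\<close>

lemma coeff_mult_2:
  "coeff (p * q) 2 = coeff p 0 * coeff q 2 + coeff p (Suc 0) * coeff q (Suc 0) + coeff p 2 * coeff q 0"
  for p q :: "complex poly"
  by (simp add: coeff_mult numeral_2_eq_2)

lemma coeff_line_poly_vanishing_ideal: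
  "f \<in> vanishing_ideal C \<Longrightarrow> p \<in> C \<Longrightarrow> coeff (line_poly f p v) 0 = 0"
  by (simp add: coeff_line_poly_0 vanishing_ideal_def)

text \<open>
  Elements of the square and the cube of the ideal have no terms of order less than two or three at a
  point of the curve, so that the local conditions on a quartic become conditions on its restrictions
  to lines.
\<close>

lemma coeff_line_poly_ideal_square:
  assumes "f \<in> ideal_square (vanishing_ideal C)" "p \<in> C"
  shows "coeff (line_poly f p v) 0 = 0 \<and> coeff (line_poly f p v) (Suc 0) = 0"
  using assms(1) unfolding ideal_square_def
  by (induction rule: ideal_generated_induct)
    (auto simp: coeff_mult_0 coeff_mult_1 coeff_line_poly_vanishing_ideal[OF _ assms(2)])

lemma coeff_line_poly_ideal_cube:
  assumes "f \<in> ideal_cube (vanishing_ideal C)" "p \<in> C"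
  shows "coeff (line_poly f p v) 0 = 0 \<and> coeff (line_poly f p v) (Suc 0) = 0 \<and> coeff (line_poly f p v) 2 = 0"
  using assms(1) unfolding ideal_cube_def
  by (induction rule: ideal_generated_induct)
    (auto simp: coeff_mult_0 coeff_mult_1 coeff_mult_2 coeff_line_poly_vanishing_ideal[OF _ assms(2)])

lemma coeff_line_poly_double_curve:
  assumes "double_curve C n G" "p \<in> C" "p \<noteq> 0"
  shows "coeff (line_poly G p v) 0 = 0" "coeff (line_poly G p v) (Suc 0) = 0"
proof -
  obtain k h where h: "eval_poly h p \<noteq> 0" "h * G \<in> ideal_square (vanishing_ideal C)"
    using assms by (auto simp: double_curve_def)
  from coeff_line_poly_ideal_square[OF h(2) assms(2), of v] h(1)
  show "coeff (line_poly G p v) 0 = 0" "coeff (line_poly G p v) (Suc 0) = 0"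
    by (auto simp: coeff_mult_0 coeff_mult_1 coeff_line_poly_0)
qed

text \<open>
  Over the complex numbers the coefficients also absorb the leading factor of the square.
\<close>

lemma degenerate_quadratic_form_is_square:
  assumes "\<beta> ^ 2 - 4 * \<alpha> * \<gamma> = (0 :: complex)"
  obtains x y where "\<And>X Y. \<alpha> * X ^ 2 + \<beta> * X * Y + \<gamma> * Y ^ 2 = (x * X + y * Y) ^ 2"
proof (cases "\<alpha> = 0")
  case True
  have "csqrt \<gamma> ^ 2 = \<gamma>" by simp
  with True assms show ?thesis
    by (intro that[of 0 "csqrt \<gamma>"]) (simp add: power_mult_distrib)
next
  case False
  define x where "x = csqrt \<alpha>"
  have x: "x ^ 2 = \<alpha>" "x \<noteq> 0"
    using False by (auto simp: x_def)
  define y where "y = \<beta> / (2 * x)"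
  have \<beta>: "\<beta> = 2 * x * y"
    using x(2) by (simp add: y_def)
  have "x ^ 2 * y ^ 2 = x ^ 2 * \<gamma>"
    using assms unfolding \<beta> x(1)[symmetric] by (simp add: algebra_simps power2_eq_square)
  then have "\<gamma> = y ^ 2"
    using x(2) by simp
  then show ?thesis
    by (intro that[of x y]) (simp add: \<beta> algebra_simps power2_eq_square flip: x(1))
qed

text \<open>
  Along a line through \<open>p\<close> in direction \<open>v\<close>, the second order term of \<open>G\<close> is the induced quadratic form
  evaluated at the derivatives of the frame; as this form is degenerate, the second order
  term is the square of a linear form in \<open>v\<close>.
\<close>

lemma second_order_at_pinch_point:
  assumes double: "double_curve C n G" and pinch: "pinch_point C n G p" and "p \<noteq> 0"
  obtains f g x y where "f \<in> vanishing_ideal C" "g \<in> vanishing_ideal C"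
    "\<And>v. coeff (line_poly G p v) 2 = (x * deriv_at f p v + y * deriv_at g p v) ^ 2"
proof -
  have p: "p \<in> C"
    using pinch by (simp add: pinch_point_def)
  obtain d f g \<alpha> \<beta> \<gamma> where frame: "conormal_frame C p d f g"
    and form: "induced_form C n G p d f g \<alpha> \<beta> \<gamma>" and disc: "\<beta> ^ 2 - 4 * \<alpha> * \<gamma> = 0"
    using pinch by (auto simp: pinch_point_def)
  have fg: "f \<in> vanishing_ideal C" "g \<in> vanishing_ideal C"
    using frame by (auto simp: conormal_frame_def)
  obtain h a b c where h: "eval_poly h p \<noteq> 0"
    and cube: "h * G - (a * f ^ 2 + b * f * g + c * g ^ 2) \<in> ideal_cube (vanishing_ideal C)"
    and abc: "\<alpha> = eval_poly a p / eval_poly h p" "\<beta> = eval_poly b p / eval_poly h p"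
      "\<gamma> = eval_poly c p / eval_poly h p"
    using form by (auto simp: induced_form_def)
  obtain x y where xy: "\<And>X Y. \<alpha> * X ^ 2 + \<beta> * X * Y + \<gamma> * Y ^ 2 = (x * X + y * Y) ^ 2"
    using degenerate_quadratic_form_is_square[OF disc] by blast
  have "coeff (line_poly G p v) 2 = (x * deriv_at f p v + y * deriv_at g p v) ^ 2" for v
  proof -
    note orders = coeff_line_poly_double_curve[OF double p \<open>p \<noteq> 0\<close>]
      coeff_line_poly_vanishing_ideal[OF fg(1) p] coeff_line_poly_vanishing_ideal[OF fg(2) p]
    note coeff_0 = orders[unfolded coeff_line_poly_0]
    have "eval_poly h p * coeff (line_poly G p v) 2 =
        eval_poly a p * deriv_at f p v ^ 2 + eval_poly b p * deriv_at f p v * deriv_at g p v +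
        eval_poly c p * deriv_at g p v ^ 2"
      using coeff_line_poly_ideal_cube[OF cube p, of v]
      by (simp add: coeff_mult_2 coeff_mult_1 coeff_mult_0 coeff_0 coeff_line_poly_0 deriv_at_def
          power2_eq_square)
    then have "coeff (line_poly G p v) 2 =
        \<alpha> * deriv_at f p v ^ 2 + \<beta> * deriv_at f p v * deriv_at g p v + \<gamma> * deriv_at g p v ^ 2"
      using h by (simp add: abc field_simps)
    then show ?thesis
      by (simp add: xy)
  qed
  with fg show ?thesis
    by (rule that)
qed

text \<open>
  Taylor expansion of \<open>b \<mapsto> \<gamma>(1, b)\<close> at \<open>a\<close>: the point \<open>\<gamma>(1, a)\<close> and the velocity there span the tangent
  line, on which the linear form is zero, so only terms of order at least two remain.
\<close>

lemma deriv_at_along_twisted_cubic: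
  assumes "f \<in> vanishing_ideal twisted_cubic"
  shows "deriv_at f (twisted_cubic_map 1 a) (twisted_cubic_map 1 b) =
    (b - a) ^ 2 * (deriv_at f (twisted_cubic_map 1 a) (vec4 0 0 1 (3 * a)) +
      (b - a) * deriv_at f (twisted_cubic_map 1 a) (vec4 0 0 0 1))"
proof -
  have "twisted_cubic_map 1 b = tangent_vector 1 a (1 / 3) (a / 3 + (b - a)) +
      ((b - a) ^ 2 *s vec4 0 0 1 (3 * a) + (b - a) ^ 3 *s vec4 0 0 0 1)"
    by (simp add: vec_4_eq_iff tangent_vector_def field_simps power2_eq_square power3_eq_cube)
  then have "deriv_at f (twisted_cubic_map 1 a) (twisted_cubic_map 1 b) =
      (b - a) ^ 2 * deriv_at f (twisted_cubic_map 1 a) (vec4 0 0 1 (3 * a)) +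
      (b - a) ^ 3 * deriv_at f (twisted_cubic_map 1 a) (vec4 0 0 0 1)"
    by (simp add: deriv_at_add deriv_at_scale deriv_at_tangent_vector[OF assms])
  then show ?thesis
    by (simp add: algebra_simps power2_eq_square power3_eq_cube)
qed

lemma twisted_cubic_map_nonzero: "twisted_cubic_map 1 a \<noteq> 0"
  by (simp add: vec_4_eq_iff)

text \<open>
  The square root of the second order term of \<open>G\<close> is a linear form; along the curve it is a cubic
  polynomial in \<open>b\<close> that has a double root at \<open>a\<close>.
\<close>

lemma second_order_along_secant:
  assumes "cuspidal_curve twisted_cubic n G"
  obtains m0 m1 where "\<And>b. coeff (line_poly G (twisted_cubic_map 1 a) (twisted_cubic_map 1 b)) 2 =
    (b - a) ^ 4 * (m0 + m1 * b) ^ 2"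
proof -
  let ?p = "twisted_cubic_map 1 a"
  have "double_curve twisted_cubic n G" "pinch_point twisted_cubic n G ?p"
    using assms twisted_cubic_map_mem[of 1 a] by (auto simp: cuspidal_curve_def)
  then obtain f g x y where fg: "f \<in> vanishing_ideal twisted_cubic" "g \<in> vanishing_ideal twisted_cubic"
    and sq: "\<And>v. coeff (line_poly G ?p v) 2 = (x * deriv_at f ?p v + y * deriv_at g ?p v) ^ 2"
    using second_order_at_pinch_point twisted_cubic_map_nonzero by metis
  define l where "l v = x * deriv_at f ?p v + y * deriv_at g ?p v" for v
  have "coeff (line_poly G ?p (twisted_cubic_map 1 b)) 2 =
    (b - a) ^ 4 * ((l (vec4 0 0 1 (3 * a)) - a * l (vec4 0 0 0 1)) + l (vec4 0 0 0 1) * b) ^ 2" for b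
  proof -
    have "l (twisted_cubic_map 1 b) =
        (b - a) ^ 2 * (l (vec4 0 0 1 (3 * a)) - a * l (vec4 0 0 0 1) + l (vec4 0 0 0 1) * b)"
      unfolding l_def deriv_at_along_twisted_cubic[OF fg(1)] deriv_at_along_twisted_cubic[OF fg(2)]
      by (simp add: algebra_simps)
    moreover have "((b - a) ^ 2) ^ 2 = (b - a) ^ 4"
      by (simp flip: power_mult)
    ultimately show ?thesis
      unfolding sq l_def[symmetric] by (simp add: power_mult_distrib)
  qed
  then show ?thesis
    by (rule that)
qed

text \<open>
  Both sides are coefficients of the binary form \<open>f(z u + w v)\<close> of degree \<open>d\<close>, dehomogenised in its two
  variables.
\<close>

lemma coeff_line_poly_swap:
  assumes "homogeneous d f"
  shows "coeff (line_poly f u v) k = (if k \<le> d then coeff (line_poly f v u) (d - k) else 0)"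
  using assms
proof (induction arbitrary: u v k rule: homogeneous_induct)
  case (const c)
  then show ?case
    by (simp add: line_poly_def coeff_pCons split: nat.split)
next
  case (mult_var e i f)
  have *: "coeff (line_poly (var i * f) u v) k =
      u $ i * coeff (line_poly f u v) k + (if k = 0 then 0 else v $ i * coeff (line_poly f u v) (k - 1))"
    for u v k
    by (cases k) (simp_all add: line_poly_def)
  show ?case
  proof (cases k)
    case 0
    have "coeff (line_poly f v u) (Suc e) = 0"
      using mult_var.IH[of v u "Suc e"] by simp
    then show ?thesis
      using mult_var.IH[of u v 0] by (simp add: * 0 del: line_poly_simps)
  next
    case (Suc j)
    consider "j < e" | "j = e" | "j > e" by linarith
    then show ?thesis
    proof cases
      case 1
      then have "e - j = Suc (e - Suc j)" by simp
      with 1 show ?thesis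
        using mult_var.IH[of u v j] mult_var.IH[of u v "Suc j"] by (simp add: * Suc del: line_poly_simps)
    next
      case 2
      then show ?thesis
        using mult_var.IH[of u v j] mult_var.IH[of u v "Suc j"] by (simp add: * Suc del: line_poly_simps)
    next
      case 3
      then show ?thesis
        using mult_var.IH[of u v j] mult_var.IH[of u v "Suc j"] by (simp add: * Suc del: line_poly_simps)
    qed
  qed
next
  case (add e f g)
  show ?case
    by (simp only: line_poly_simps coeff_add add.IH(1)[of u v k] add.IH(2)[of u v k]) simp
qed simp

text \<open>
  On a secant, a quartic with the double curve has a double zero at both points of the curve, so only
  the middle one of its five coefficients can be non-zero.
\<close>

lemma eval_poly_secant:
  assumes "cuspidal_curve twisted_cubic 4 G"
  shows "eval_poly G (z *s twisted_cubic_map 1 a + w *s twisted_cubic_map 1 b) =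
    coeff (line_poly G (twisted_cubic_map 1 a) (twisted_cubic_map 1 b)) 2 * z ^ 2 * w ^ 2"
proof -
  let ?u = "twisted_cubic_map 1 a" and ?v = "twisted_cubic_map 1 b"
  let ?P = "line_poly G ?u ?v"
  have double: "double_curve twisted_cubic 4 G" and hom: "homogeneous 4 G"
    using assms by (auto simp: cuspidal_curve_def double_curve_def)
  have ord: "coeff (line_poly G (twisted_cubic_map 1 c) v) 0 = 0"
    "coeff (line_poly G (twisted_cubic_map 1 c) v) (Suc 0) = 0" for c v
    using coeff_line_poly_double_curve[OF double _ twisted_cubic_map_nonzero]
      twisted_cubic_map_mem[of 1 c] by auto
  have "?P = monom (coeff ?P 2) 2"
  proof (rule poly_eqI)
    fix k
    consider "k = 0" | "k = Suc 0" | "k = 2" | "k = 3" | "k = 4" | "k > 4" by linarith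
    then show "coeff ?P k = coeff (monom (coeff ?P 2) 2) k"
      by cases (use coeff_line_poly_swap[OF hom, of ?u ?v k] in \<open>auto simp: ord\<close>)
  qed
  then have "poly ?P x = coeff ?P 2 * x ^ 2" for x
    by (metis poly_monom)
  then have line: "eval_poly G (?u + x *s ?v) = coeff ?P 2 * x ^ 2" for x
    by (simp add: poly_line_poly)
  show ?thesis
  proof (cases "z = 0")
    case True
    have "eval_poly G ?v = 0"
      using ord(1)[of b 0] by (simp add: coeff_line_poly_0)
    with True show ?thesis
      by (simp add: eval_poly_scale[OF hom])
  next
    case False
    then have "z *s ?u + w *s ?v = z *s (?u + (w / z) *s ?v)"
      by (simp add: vec_eq_iff algebra_simps)
    then have "eval_poly G (z *s ?u + w *s ?v) = z ^ 4 * (coeff ?P 2 * (w / z) ^ 2)"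
      by (simp only: eval_poly_scale[OF hom] line)
    also have "\<dots> = coeff ?P 2 * z ^ 2 * w ^ 2"
      using False by (simp add: field_simps flip: power_add)
    finally show ?thesis .
  qed
qed

text \<open>
  By interpolation in one variable and symmetry, \<open>N\<close> is a symmetric polynomial of bidegree \<open>(2, 2)\<close>, hence
  a quadratic form in \<open>1, a + b, a b\<close>.  Geometrically it is the equation of a conic that
  restricts to a square on every tangent line of the conic \<open>\<sigma>\<^sup>2 = 4 \<pi>\<close>, which are the lines with \<open>a\<close>
  fixed.  Up to a constant, it is then the equation of this conic or the square of a linear form.
  Algebraically, the discriminant in \<open>b\<close> is a quartic polynomial in \<open>a\<close> all of
  whose coefficients vanish, and these five equations have only the stated solutions.
\<close>

lemma symmetric_biquadratic_of_squares:
  fixes N :: "complex \<Rightarrow> complex \<Rightarrow> complex"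
  assumes sq: "\<And>a b. N a b = (m0 a + m1 a * b) ^ 2"
    and sym: "\<And>a b. N a b = N b a"
  shows "(\<exists>\<kappa>. \<forall>a b. N a b = \<kappa> * (a - b) ^ 2) \<or>
    (\<exists>\<alpha> \<beta> \<gamma>. \<forall>a b. N a b = (\<alpha> + \<beta> * (a + b) + \<gamma> * (a * b)) ^ 2)"
proof -
  define A B C where "A a = m0 a ^ 2" and "B a = 2 * m0 a * m1 a" and "C a = m1 a ^ 2" for a
  have N: "N a b = A a + B a * b + C a * b ^ 2" for a b
    by (simp add: sq A_def B_def C_def algebra_simps power2_eq_square)
  have disc: "B a ^ 2 = 4 * A a * C a" for a
    by (simp add: A_def B_def C_def power_mult_distrib)
  define p q r where "p = A 0" and "q = B 0" and "r = C 0"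
  have A: "A a = p + q * a + r * a ^ 2" for a
    using sym[of a 0] by (simp add: N p_def q_def r_def)
  have sum: "A a + B a + C a = A 1 + B 1 * a + C 1 * a ^ 2"
    and diff: "A a - B a + C a = A (- 1) + B (- 1) * a + C (- 1) * a ^ 2" for a
    using sym[of a 1] sym[of a "- 1"] by (simp_all add: N)
  define m n k where "m = (B 1 - B (- 1)) / 2" and "n = (C 1 - C (- 1)) / 2"
    and "k = (C 1 + C (- 1)) / 2 - r"
  have B2: "2 * B a = A 1 - A (- 1) + (B 1 - B (- 1)) * a + (C 1 - C (- 1)) * a ^ 2" for a
  proof -
    have "2 * B a = (A a + B a + C a) - (A a - B a + C a)" by simp
    then show ?thesis
      unfolding sum diff by (simp add: algebra_simps)
  qed
  have B: "B a = q + m * a + n * a ^ 2" for a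
  proof -
    have "A 1 - A (- 1) = 2 * q" "B 1 - B (- 1) = 2 * m" "C 1 - C (- 1) = 2 * n"
      by (simp_all add: A m_def n_def)
    then have "2 * B a = 2 * (q + m * a + n * a ^ 2)"
      unfolding B2 by (simp only:) (simp add: algebra_simps)
    then show ?thesis
      by (metis mult_left_cancel zero_neq_numeral)
  qed
  have "2 * C a = A 1 + A (- 1) + (B 1 + B (- 1)) * a + (C 1 + C (- 1)) * a ^ 2 - 2 * A a" for a
  proof -
    have "2 * C a = (A a + B a + C a) + (A a - B a + C a) - 2 * A a" by simp
    then show ?thesis
      unfolding sum diff by (simp add: algebra_simps)
  qed
  moreover have "A 1 + A (- 1) = 2 * p + 2 * r" "B 1 + B (- 1) = 2 * q + 2 * n"
    by (simp_all add: A B)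
  moreover have "C 1 + C (- 1) = 2 * r + 2 * k"
    by (simp add: k_def field_simps)
  ultimately have "2 * C a = 2 * (r + n * a + k * a ^ 2)" for a
    by (simp only: A) (simp add: algebra_simps)
  then have C: "C a = r + n * a + k * a ^ 2" for a
    by (metis mult_left_cancel zero_neq_numeral)
  have "[:q ^ 2 - 4 * p * r, 2 * q * m - 4 * (p * n + q * r),
      m ^ 2 + 2 * q * n - 4 * (p * k + q * n + r ^ 2), 2 * m * n - 4 * (q * k + r * n),
      n ^ 2 - 4 * r * k:] = 0"
  proof (rule poly_eqI_complex)
    fix a
    show "poly [:q ^ 2 - 4 * p * r, 2 * q * m - 4 * (p * n + q * r),
      m ^ 2 + 2 * q * n - 4 * (p * k + q * n + r ^ 2), 2 * m * n - 4 * (q * k + r * n),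
      n ^ 2 - 4 * r * k:] a = poly 0 a"
      using disc[of a] unfolding A B C by (simp add: algebra_simps power2_eq_square)
  qed
  then have e: "q ^ 2 = 4 * p * r" "2 * q * m = 4 * (p * n + q * r)"
    "m ^ 2 + 2 * q * n = 4 * (p * k + q * n + r ^ 2)" "2 * m * n = 4 * (q * k + r * n)"
    "n ^ 2 = 4 * r * k"
    by (simp_all only: pCons_eq_0_iff right_minus_eq)
  \<comment> \<open>The coefficients \<open>q\<close>, \<open>r\<close>, \<open>n\<close> occur twice because of the symmetry.\<close>
  have N_eq: "N a b = p + q * (a + b) + r * (a ^ 2 + b ^ 2) + m * (a * b) + n * (a * b) * (a + b)
      + k * (a * b) ^ 2" for a b
    unfolding N A B C by (simp add: algebra_simps power2_eq_square)
  show ?thesis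
  proof (cases "r = 0")
    case True
    with e have "q = 0" "n = 0" by simp_all
    with e(3) True have "m ^ 2 - 4 * p * k = 0" by simp
    then obtain x y where "\<And>X Y. p * X ^ 2 + m * X * Y + k * Y ^ 2 = (x * X + y * Y) ^ 2"
      using degenerate_quadratic_form_is_square by blast
    from this[of 1] have "N a b = (x + 0 * (a + b) + y * (a * b)) ^ 2" for a b
      unfolding N_eq using True \<open>q = 0\<close> \<open>n = 0\<close> by simp
    then show ?thesis by blast
  next
    case False
    have "q * (2 * r * m - q * n - 4 * r ^ 2) = 0" "n * (2 * r * m - q * n - 4 * r ^ 2) = 0"
      using e by algebra+
    then consider "2 * r * m - q * n - 4 * r ^ 2 = 0" | "q = 0" "n = 0" "2 * r * m - q * n - 4 * r ^ 2 \<noteq> 0"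
      unfolding mult_eq_0_iff by blast
    then show ?thesis
    proof cases
      case 1
      then have m: "2 * r * m = q * n + 4 * r ^ 2"
        by (simp add: algebra_simps)
      define s where "s = csqrt r"
      have s: "s ^ 2 = r" "s \<noteq> 0"
        using False by (auto simp: s_def)
      define \<alpha> \<gamma> where "\<alpha> = q / (2 * s)" and "\<gamma> = n / (2 * s)"
      have qn: "q = 2 * s * \<alpha>" "n = 2 * s * \<gamma>"
        using s(2) by (simp_all add: \<alpha>_def \<gamma>_def)
      have "s ^ 2 * p = s ^ 2 * \<alpha> ^ 2" "s ^ 2 * k = s ^ 2 * \<gamma> ^ 2"
        "s ^ 2 * m = s ^ 2 * (2 * \<alpha> * \<gamma> + 2 * s ^ 2)"
        using e(1,5) m unfolding qn s(1)[symmetric] by algebra+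
      then have "p = \<alpha> ^ 2" "k = \<gamma> ^ 2" "m = 2 * \<alpha> * \<gamma> + 2 * s ^ 2"
        using s(2) by simp_all
      then have "N a b = (\<alpha> + s * (a + b) + \<gamma> * (a * b)) ^ 2" for a b
        unfolding N_eq qn s(1)[symmetric] by (simp add: algebra_simps power2_eq_square)
      then show ?thesis by blast
    next
      case 2
      with e False have "p = 0" "k = 0" by simp_all
      with e(3) 2 have "(m - 2 * r) * (m + 2 * r) = 0"
        by (simp add: algebra_simps power2_eq_square)
      moreover have "m \<noteq> 2 * r"
        using 2 by (auto simp: power2_eq_square)
      ultimately have "m = - 2 * r"
        by (simp add: eq_neg_iff_add_eq_0)
      with 2 \<open>p = 0\<close> \<open>k = 0\<close> have "N a b = r * (a - b) ^ 2" for a b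
        unfolding N_eq by (simp add: algebra_simps power2_eq_square)
      then show ?thesis by blast
    qed
  qed
qed

text \<open>
  If \<open>q\<^sub>0\<close> and the discriminant of \<open>q\<^sub>0 T\<^sup>2 - q\<^sub>1 T + q\<^sub>2\<close> are non-zero at a point, its roots \<open>a \<noteq> b\<close> are the
  parameters of a secant through the point: the syzygies say that the coordinates obey the linear
  recurrence with characteristic roots \<open>a\<close> and \<open>b\<close>.  The remaining points lie on a hypersurface.
\<close>

lemma secants_dense:
  assumes "\<And>z w a b. eval_poly H (z *s twisted_cubic_map 1 a + w *s twisted_cubic_map 1 b) = 0"
  shows "H = 0"
proof -
  have "eval_poly (H * (quadric0 * discriminant_quartic)) v = 0" for v
  proof (rule ccontr)
    assume neq: "eval_poly (H * (quadric0 * discriminant_quartic)) v \<noteq> 0"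
    define x0 x1 x2 x3 where x: "x0 = v $ 0" "x1 = v $ 1" "x2 = v $ 2" "x3 = v $ 3"
    define q0 q1 q2 where q: "q0 = x0 * x2 - x1 * x1" "q1 = x0 * x3 - x1 * x2" "q2 = x1 * x3 - x2 * x2"
    define \<delta> where "\<delta> = csqrt (q1 ^ 2 - 4 * q0 * q2)"
    have nz: "eval_poly H v \<noteq> 0" "q0 \<noteq> 0" "q1 ^ 2 - 4 * q0 * q2 \<noteq> 0"
      using neq by (auto simp: eval_discriminant_quartic q x)
    have \<delta>: "\<delta> ^ 2 = q1 ^ 2 - 4 * q0 * q2" "\<delta> \<noteq> 0"
      using nz by (auto simp: \<delta>_def)
    define a b where "a = (q1 + \<delta>) / (2 * q0)" and "b = (q1 - \<delta>) / (2 * q0)"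
    have "b \<noteq> a"
      using \<delta>(2) nz by (simp add: a_def b_def)
    have sum: "q1 = q0 * (a + b)"
      using nz by (simp add: a_def b_def field_simps)
    have "4 * q0 ^ 2 * (a * b) = q1 ^ 2 - \<delta> ^ 2"
      using nz by (simp add: a_def b_def field_simps power2_eq_square)
    then have "q0 * q2 = q0 * (q0 * (a * b))"
      unfolding \<delta>(1) by (auto simp: power2_eq_square)
    then have prod: "q2 = q0 * (a * b)"
      using nz by simp
    have "q0 * x2 = q1 * x1 - q2 * x0" "q0 * x3 = q1 * x2 - q2 * x1"
      by (simp_all add: q algebra_simps)
    then have "q0 * x2 = q0 * ((a + b) * x1 - a * b * x0)" "q0 * x3 = q0 * ((a + b) * x2 - a * b * x1)"
      unfolding sum prod by (simp_all add: algebra_simps)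
    then have rec: "x2 = (a + b) * x1 - a * b * x0" "x3 = (a + b) * x2 - a * b * x1"
      using nz by simp_all
    define w where "w = (x1 - a * x0) / (b - a)"
    have "w * (b - a) = x1 - a * x0"
      using \<open>b \<noteq> a\<close> by (simp add: w_def)
    then have x1: "x1 = (x0 - w) * a + w * b"
      by (simp add: algebra_simps)
    have x2: "x2 = (x0 - w) * a ^ 2 + w * b ^ 2"
      unfolding rec(1) x1 by (simp add: algebra_simps power2_eq_square)
    have x3: "x3 = (x0 - w) * a ^ 3 + w * b ^ 3"
      unfolding rec(2) x2 x1 by (simp add: algebra_simps power2_eq_square power3_eq_cube)
    have "v = (x0 - w) *s twisted_cubic_map 1 a + w *s twisted_cubic_map 1 b"
      using x1 x2 x3 by (simp add: vec_4_eq_iff left_diff_distrib flip: x)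
    with assms nz(1) show False by metis
  qed
  then have "H * (quadric0 * discriminant_quartic) = 0"
    by (rule eval_poly_eq_0_imp)
  moreover have "eval_poly quadric0 (vec4 1 0 1 0) = 1" "eval_poly discriminant_quartic (vec4 1 0 0 1) = 1"
    by (simp_all add: eval_discriminant_quartic)
  then have "quadric0 \<noteq> 0" "discriminant_quartic \<noteq> 0"
    by (metis eval_poly_0 zero_neq_one)+
  ultimately show ?thesis by simp
qed

lemma eval_quadrics_secant:
  "eval_poly quadric0 (z *s twisted_cubic_map 1 a + w *s twisted_cubic_map 1 b) = z * w * (b - a) ^ 2"
  "eval_poly quadric1 (z *s twisted_cubic_map 1 a + w *s twisted_cubic_map 1 b) = z * w * (b - a) ^ 2 * (a + b)"
  "eval_poly quadric2 (z *s twisted_cubic_map 1 a + w *s twisted_cubic_map 1 b) = z * w * (b - a) ^ 2 * (a * b)"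
  by (simp_all add: algebra_simps power2_eq_square power3_eq_cube)

text \<open>
  On the secant with parameters \<open>a\<close> and \<open>b\<close>, the quadrics are proportional to \<open>1, a + b, a b\<close>.  The two
  solutions for \<open>N\<close> are therefore the restrictions of a multiple of \<open>q\<^sub>1\<^sup>2 - 4 q\<^sub>0 q\<^sub>2\<close> and of the square of a
  linear combination of the quadrics, and a polynomial is determined by its values on the secants.
\<close>

theorem cuspidal_quartic_cases:
  assumes "cuspidal_curve twisted_cubic 4 G"
  obtains \<kappa> where "G = const_poly \<kappa> * discriminant_quartic"
  | A where "A \<in> vanishing_ideal twisted_cubic" "G = A * A"
proof -
  let ?c = "\<lambda>a b. coeff (line_poly G (twisted_cubic_map 1 a) (twisted_cubic_map 1 b)) 2"
  have "\<exists>m0 m1. \<forall>b. ?c a b = (b - a) ^ 4 * (m0 + m1 * b) ^ 2" for a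
    using second_order_along_secant[OF assms, of a] by metis
  then obtain m0 m1 where c: "\<And>a b. ?c a b = (b - a) ^ 4 * (m0 a + m1 a * b) ^ 2"
    by metis
  define N where "N a b = (m0 a + m1 a * b) ^ 2" for a b
  have hom: "homogeneous 4 G"
    using assms by (auto simp: cuspidal_curve_def double_curve_def)
  have "N a b = N b a" for a b
  proof (cases "a = b")
    case False
    have "?c a b = ?c b a"
      using coeff_line_poly_swap[OF hom, of "twisted_cubic_map 1 a" "twisted_cubic_map 1 b" 2] by simp
    moreover have "(a - b) ^ 4 = (b - a) ^ 4"
      by algebra
    ultimately show ?thesis
      using False by (simp add: c N_def)
  qed simp
  from symmetric_biquadratic_of_squares[OF N_def this]
  consider \<kappa> where "\<And>a b. N a b = \<kappa> * (a - b) ^ 2"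
    | \<alpha> \<beta> \<gamma> where "\<And>a b. N a b = (\<alpha> + \<beta> * (a + b) + \<gamma> * (a * b)) ^ 2"
    by blast
  then show ?thesis
  proof cases
    case (1 \<kappa>)
    have "G - const_poly \<kappa> * discriminant_quartic = 0"
    proof (rule secants_dense)
      fix z w a b
      show "eval_poly (G - const_poly \<kappa> * discriminant_quartic)
          (z *s twisted_cubic_map 1 a + w *s twisted_cubic_map 1 b) = 0"
        unfolding eval_poly_diff eval_poly_secant[OF assms] c N_def[symmetric] 1
          discriminant_quartic_def eval_poly_mult eval_poly_power eval_quadrics_secant eval_poly_const
          eval_poly_numeral
        by algebra
    qed
    then show ?thesis
      by (intro that(1)[of \<kappa>]) simp
  next
    case (2 \<alpha> \<beta> \<gamma>)
    define A where "A = const_poly \<alpha> * quadric0 + const_poly \<beta> * quadric1 + const_poly \<gamma> * quadric2"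
    have "G - A * A = 0"
    proof (rule secants_dense)
      fix z w a b
      show "eval_poly (G - A * A) (z *s twisted_cubic_map 1 a + w *s twisted_cubic_map 1 b) = 0"
        unfolding A_def eval_poly_diff eval_poly_secant[OF assms] c N_def[symmetric] 2
          eval_poly_mult eval_poly_add eval_quadrics_secant eval_poly_const
        by algebra
    qed
    moreover have "A \<in> vanishing_ideal twisted_cubic"
      using quadrics_in_vanishing_ideal by (simp add: A_def vanishing_ideal_def del: eval_quadrics)
    ultimately show ?thesis
      by (intro that(2)[of A]) simp_all
  qed
qed

section \<open>Existence and uniqueness\<close>

theorem theorem6p1:
  "\<exists>F. irreducible_surface 4 F \<and> zero_locus F = tangential_developable twisted_cubic \<and>
       cuspidal_curve twisted_cubic 4 F \<and>
       (\<forall>G. irreducible_surface 4 G \<and> cuspidal_curve twisted_cubic 4 G \<longrightarrow>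
            (\<exists>c. c \<noteq> 0 \<and> G = const_poly c * F))"
proof (intro exI[of _ discriminant_quartic] conjI allI impI)
  show "irreducible_surface 4 discriminant_quartic"
    by (simp add: irreducible_surface_def homogeneous_discriminant_quartic irreducible_discriminant_quartic)
  show "zero_locus discriminant_quartic = tangential_developable twisted_cubic"
    by (rule zero_locus_discriminant_quartic)
  show "cuspidal_curve twisted_cubic 4 discriminant_quartic"
    by (rule cuspidal_curve_discriminant_quartic)
next
  fix G assume G: "irreducible_surface 4 G \<and> cuspidal_curve twisted_cubic 4 G"
  then have irr: "irreducible G"
    by (simp add: irreducible_surface_def)
  from G have "cuspidal_curve twisted_cubic 4 G" by simp
  then show "\<exists>c. c \<noteq> 0 \<and> G = const_poly c * discriminant_quartic"
  proof (rule cuspidal_quartic_cases)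
    fix \<kappa> assume \<kappa>: "G = const_poly \<kappa> * discriminant_quartic"
    with irr have "\<kappa> \<noteq> 0"
      by (auto simp: const_poly_def)
    with \<kappa> show ?thesis by blast
  next
    fix A assume A: "A \<in> vanishing_ideal twisted_cubic" "G = A * A"
    with irr have "A dvd 1"
      using irreducibleD by blast
    then obtain B where "1 = A * B" ..
    then have "eval_poly 1 (twisted_cubic_map 1 0) = eval_poly (A * B) (twisted_cubic_map 1 0)"
      by simp
    with A(1) show ?thesis
      by (simp add: eval_poly_twisted_cubic_map_eq_0)
  qed
qed

end
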